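(* Let $N\ge2$. There exist pairs of analytic maps $\Phi_1,\Phi_2\colon\mathbb{D}^N\to\mathbb{D}^N$ with $\Phi_1(\mathbb{D}^N)=\Phi_2(\mathbb{D}^N)$ realizing each of the following four situations (for composition operators on $H^2(\mathbb{D}^N)$): (1) $C_{\Phi_1}$ is not bounded, while $C_{\Phi_2}$ is compact with $\beta_N(C_{\Phi_2})=0$; (2) $C_{\Phi_1}$ is bounded but not compact (so $\beta_N(C_{\Phi_1})=1$), while $C_{\Phi_2}$ is compact with $\beta_N(C_{\Phi_2})=0$; (3) $C_{\Phi_1}$ is compact with $\beta_N^-(C_{\Phi_1})>0$ and $\beta_N^+(C_{\Phi_1})<1$, while $C_{\Phi_2}$ is compact with $\beta_N(C_{\Phi_2})=0$; (4) $C_{\Phi_1}$ is compact with $\beta_N(C_{\Phi_1})=1$, while $C_{\Phi_2}$ is compact with $\beta_N(C_{\Phi_2})=0$.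
   Context: $H^2(\mathbb{D}^N)$ is the Hardy space of the polydisk: analytic $f=\sum_{\alpha\in\mathbb{N}^N}a_\alpha z^\alpha$ with $\|f\|^2=\sum_\alpha|a_\alpha|^2<\infty$; $C_\Phi f=f\circ\Phi$. The approximation numbers are $a_n(T)=\inf\{\|T-R\|:\operatorname{rank}R<n\}$. For an operator $T$, $\beta_N^-(T)=\liminf_{n\to\infty}[a_n(T)]^{1/n^{1/N}}$, $\beta_N^+(T)=\limsup_{n\to\infty}[a_n(T)]^{1/n^{1/N}}$, and $\beta_N(T)$ denotes their common value when they coincide. *)

theory Defs
  imports "HOL-Analysis.Analysis"
begin

definition polydisk :: "(complex ^ 'n::finite) set" where
  "polydisk = {z. \<forall>i. cmod (z $ i) < 1}"

definition monom :: "complex ^ 'n::finite \<Rightarrow> ('n \<Rightarrow> nat) \<Rightarrow> complex" where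
  "monom z \<alpha> = (\<Prod>i\<in>UNIV. (z $ i) ^ (\<alpha> i))"

definition holo_polydisk :: "(complex ^ 'n::finite \<Rightarrow> complex) \<Rightarrow> bool" where
  "holo_polydisk f \<longleftrightarrow> (\<forall>z\<in>polydisk. \<exists>D. (f has_derivative D) (at z) \<and>
       (\<forall>c v. D (c *s v) = c * D v))"

definition analytic_self_map :: "(complex ^ 'n::finite \<Rightarrow> complex ^ 'n) \<Rightarrow> bool" where
  "analytic_self_map \<Phi> \<longleftrightarrow> (\<forall>z\<in>polydisk. \<Phi> z \<in> polydisk) \<and>
       (\<forall>i. holo_polydisk (\<lambda>z. \<Phi> z $ i))"

definition has_coeffs :: "(complex ^ 'n::finite \<Rightarrow> complex) \<Rightarrow> (('n \<Rightarrow> nat) \<Rightarrow> complex) \<Rightarrow> bool" where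
  "has_coeffs f a \<longleftrightarrow> (\<forall>z\<in>polydisk. ((\<lambda>\<alpha>. a \<alpha> * monom z \<alpha>) has_sum f z) UNIV)"

text \<open>The Hardy space H^2 of the polydisk (functions are identified on the polydisk).\<close>
definition H2 :: "(complex ^ 'n::finite \<Rightarrow> complex) set" where
  "H2 = {f. \<exists>a. has_coeffs f a \<and> (\<lambda>\<alpha>. (cmod (a \<alpha>))\<^sup>2) summable_on UNIV}"

definition h2coef :: "(complex ^ 'n::finite \<Rightarrow> complex) \<Rightarrow> ('n \<Rightarrow> nat) \<Rightarrow> complex" where
  "h2coef f = (SOME a. has_coeffs f a)"

definition h2norm :: "(complex ^ 'n::finite \<Rightarrow> complex) \<Rightarrow> real" where
  "h2norm f = sqrt (infsum (\<lambda>\<alpha>. (cmod (h2coef f \<alpha>))\<^sup>2) UNIV)"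

definition comp_op :: "(complex ^ 'n::finite \<Rightarrow> complex ^ 'n) \<Rightarrow>
    (complex ^ 'n \<Rightarrow> complex) \<Rightarrow> (complex ^ 'n \<Rightarrow> complex)" where
  "comp_op \<Phi> f = (\<lambda>z. f (\<Phi> z))"

definition comp_bounded :: "(complex ^ 'n::finite \<Rightarrow> complex ^ 'n) \<Rightarrow> bool" where
  "comp_bounded \<Phi> \<longleftrightarrow> (\<forall>f\<in>H2. comp_op \<Phi> f \<in> H2) \<and>
     (\<exists>C. \<forall>f\<in>H2. h2norm (comp_op \<Phi> f) \<le> C * h2norm f)"

definition comp_compact :: "(complex ^ 'n::finite \<Rightarrow> complex ^ 'n) \<Rightarrow> bool" where
  "comp_compact \<Phi> \<longleftrightarrow> comp_bounded \<Phi> \<and>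
     (\<forall>fs :: nat \<Rightarrow> complex ^ 'n \<Rightarrow> complex. (\<forall>j. fs j \<in> H2 \<and> h2norm (fs j) \<le> 1) \<longrightarrow>
        (\<exists>r g. strict_mono r \<and> g \<in> H2 \<and>
           (\<lambda>j. h2norm (\<lambda>z. comp_op \<Phi> (fs (r j)) z - g z)) \<longlonglongrightarrow> 0))"

text \<open>Approximation numbers a_n(T) = inf { ||T - R|| : rank R < n }, where an operator of
  rank < n is R f = sum_{i<k} l_i(f) g_i with k < n, g_i in H2 and l_i linear on H2;
  ||T - R|| is the least c such that ||T f - R f|| <= c ||f|| for all f in H2.\<close>
definition approx_num :: "((complex ^ 'n::finite \<Rightarrow> complex) \<Rightarrow> (complex ^ 'n \<Rightarrow> complex))
    \<Rightarrow> nat \<Rightarrow> real" where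
  "approx_num T n = Inf {c. c \<ge> 0 \<and>
     (\<exists>k (l :: nat \<Rightarrow> (complex ^ 'n \<Rightarrow> complex) \<Rightarrow> complex) g. k < n \<and>
        (\<forall>i<k. g i \<in> H2 \<and>
           (\<forall>f\<in>H2. \<forall>h\<in>H2. l i (\<lambda>z. f z + h z) = l i f + l i h) \<and>
           (\<forall>f\<in>H2. \<forall>a. l i (\<lambda>z. a * f z) = a * l i f)) \<and>
        (\<forall>f\<in>H2. h2norm (\<lambda>z. T f z - (\<Sum>i<k. l i f * g i z)) \<le> c * h2norm f))}"

definition beta_minus :: "((complex ^ 'n::finite \<Rightarrow> complex) \<Rightarrow> (complex ^ 'n \<Rightarrow> complex))
    \<Rightarrow> ereal" where
  "beta_minus T = liminf (\<lambda>n. ereal (approx_num T n powr (1 / (real n powr (1 / real CARD('n))))))"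

definition beta_plus :: "((complex ^ 'n::finite \<Rightarrow> complex) \<Rightarrow> (complex ^ 'n \<Rightarrow> complex))
    \<Rightarrow> ereal" where
  "beta_plus T = limsup (\<lambda>n. ereal (approx_num T n powr (1 / (real n powr (1 / real CARD('n))))))"

definition beta_eq :: "((complex ^ 'n::finite \<Rightarrow> complex) \<Rightarrow> (complex ^ 'n \<Rightarrow> complex))
    \<Rightarrow> ereal \<Rightarrow> bool" where
  "beta_eq T b \<longleftrightarrow> beta_minus T = b \<and> beta_plus T = b"

end

theory Submission
  imports Defs "HOL-Complex_Analysis.Complex_Analysis" "HOL-Real_Asymp.Real_Asymp"
begin

text \<open>
  All symbols have the form \<open>\<Phi>(z) = \<sigma>(z\<^sub>i) z\<^sub>j\<close> in the coordinates of a set \<open>S\<close> and \<open>0\<close> in the others,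
  with \<open>\<sigma>\<close> a self-map of the disk such that \<open>sup |\<sigma>| = 1\<close>; the image is then always the full disk
  embedded diagonally in the coordinates \<open>S\<close>.  The factor \<open>z\<^sub>j\<close> makes the powers of \<open>\<sigma>(z\<^sub>i) z\<^sub>j\<close> orthogonal,
  so for \<open>S = {i}\<close> the operator is diagonal with singular values \<open>s\<^sub>k = \<parallel>\<sigma>^k\<parallel>\<close>, the norm
  being that of the Hardy space of the disk; for general \<open>S\<close> only a factor polynomial in \<open>k\<close> is lost.
  The cusp map \<open>\<sigma> = exp (- L powr (- p))\<close> with \<open>L = 2 p + 1 - Ln (1 - z)\<close> has \<open>- ln s\<^sub>k\<close> of order
  \<open>k powr (1 / (p + 1))\<close>: \<open>p = N - 1\<close> gives case (3), \<open>p = N\<close> case (4), and \<open>p = 1 / 2\<close> the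
  map with \<open>\<beta> = 0\<close>.  The constant \<open>\<sigma> = 1\<close> gives case (2) for \<open>S = {i}\<close> and
  case (1) for \<open>S = UNIV\<close>.
\<close>

section \<open>Bessel's inequality from a harmonic majorant\<close>

text \<open>The exponent \<open>1 / (p + 1)\<close> comes from a balance. At distance exp (-x) from
  the boundary point 1, \<open>L\<close> has size about x, so the k-th power of \<sigma> has size
  about exp (-k x^(-p)) there, while this neighbourhood contributes a weight of only about exp (-x)
  to the Hardy norm. The two costs agree at x = k^(1/(p+1)). As approximation numbers are measured
  against n^(1/N), the critical value is p + 1 = N. The image sees nothing of this: z_j varies
  independently of z_i, so only sup |\<sigma>| matters for the image, whereas the operator feels how
  much of the disk comes near the unit circle. The polynomial factor appears because a diagonal over
  several coordinates identifies all monomials of equal degree. It is harmless against the decay of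
  the cusp powers and fatal for a constant \<sigma> of modulus 1. Boundary values are avoided
  throughout: upper estimates evaluate a harmonic majorant at the origin, lower estimates use point
  evaluations.\<close>

lemma mean_value_circlepath:
  assumes "f holomorphic_on ball 0 1" "0 < r" "r < 1"
  shows "((\<lambda>t. f (circlepath 0 r t)) has_integral f 0) {0..1}"
proof -
  have "f holomorphic_on cball 0 r"
    using assms by (auto intro: holomorphic_on_subset)
  then have "((\<lambda>u. f u / (u - 0)) has_contour_integral (2 * of_real pi * \<i> * f 0)) (circlepath 0 r)"
    by (rule Cauchy_integral_circlepath_simple) (use assms in auto)
  then have *: "((\<lambda>t. f (circlepath 0 r t) / circlepath 0 r t *
      vector_derivative (circlepath 0 r) (at t within {0..1})) has_integral 2 * of_real pi * \<i> * f 0) {0..1}"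
    by (simp add: has_contour_integral_def)
  have "((\<lambda>t. 2 * of_real pi * \<i> * f (circlepath 0 r t)) has_integral 2 * of_real pi * \<i> * f 0) {0..1}"
    by (rule has_integral_eq[OF _ *])
      (use assms in \<open>simp add: vector_derivative_circlepath01, simp add: circlepath field_simps\<close>)
  then have "((\<lambda>t. (1 / (2 * of_real pi * \<i>)) * (2 * of_real pi * \<i> * f (circlepath 0 r t))) has_integral
      (1 / (2 * of_real pi * \<i>)) * (2 * of_real pi * \<i> * f 0)) {0..1}"
    by (rule has_integral_mult_right)
  then show ?thesis by (simp add: field_simps)
qed

lemma integrable_circlepath:
  fixes f :: "complex \<Rightarrow> 'a::banach"
  assumes "continuous_on (ball 0 1) f" "0 < r" "r < 1"
  shows "(\<lambda>t. f (circlepath 0 r t)) integrable_on {0..1}"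
proof (rule integrable_continuous_real)
  have "circlepath 0 r ` {0..1} \<subseteq> ball 0 1"
    using assms by (auto simp: circlepath norm_mult)
  moreover have "continuous_on {0..1} (circlepath 0 r)"
    unfolding circlepath by (intro continuous_intros)
  ultimately show "continuous_on {0..1} (\<lambda>t. f (circlepath 0 r t))"
    using continuous_on_compose2[OF assms(1)] by blast
qed

text \<open>Peeling off one coefficient at a time replaces the orthogonality of all powers: the
  induction hypothesis is applied to the shifted series, so \<open>c\<close> and \<open>f\<close>
  have to be general.\<close>

lemma bessel_circlepath:
  assumes "\<And>z. norm z < 1 \<Longrightarrow> (\<lambda>m. c m * z ^ m) sums f z" "0 < r" "r < 1"
  shows "(\<Sum>m<K. (norm (c m))\<^sup>2 * r ^ (2 * m)) \<le>
    integral {0..1} (\<lambda>t. (norm (f (circlepath 0 r t)))\<^sup>2)"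
  using assms(1)
proof (induction K arbitrary: c f)
  case 0
  \<comment> \<open>The case split makes integrability unnecessary at this point: the integral of a
    non-integrable function is 0 by convention.\<close>
  then show ?case
    by (cases "(\<lambda>t. (norm (f (circlepath 0 r t)))\<^sup>2) integrable_on {0..1}")
      (auto intro: integral_nonneg simp: not_integrable_integral)
next
  case (Suc K)
  let ?\<gamma> = "circlepath 0 r"
  \<comment> \<open>In \<open>f z = c 0 + z * h z\<close> the cross term has mean \<open>0\<close> over the circle.\<close>
  define h where "h z = (\<Sum>m. c (Suc m) * z ^ m)" for z
  have hs: "(\<lambda>m. c (Suc m) * z ^ m) sums h z" if "norm z < 1" for z
    unfolding h_def using powser_split_head(3)[OF sums_summable[OF Suc.prems[OF that]]]
    by (rule summable_sums)
  have fh: "f z = c 0 + z * h z" if "norm z < 1" for z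
    using powser_split_head(1)[OF sums_summable[OF Suc.prems[OF that]]] sums_unique[OF Suc.prems[OF that]]
    by (simp add: h_def mult.commute)
  have hol: "h holomorphic_on ball 0 1"
    by (rule power_series_holomorphic[where a = "\<lambda>m. c (Suc m)"]) (use hs in simp)
  then have cont: "continuous_on (ball 0 1) h"
    by (rule holomorphic_on_imp_continuous_on)
  have I1: "((\<lambda>t. cnj (c 0) * (?\<gamma> t * h (?\<gamma> t))) has_integral cnj (c 0) * (0 * h 0)) {0..1}"
    by (rule mean_value_circlepath[of "\<lambda>z. cnj (c 0) * (z * h z)"])
      (intro holomorphic_intros hol assms)+
  then have I1: "((\<lambda>t. Re (cnj (c 0) * (?\<gamma> t * h (?\<gamma> t)))) has_integral 0) {0..1}"
    using has_integral_linear[OF I1 bounded_linear_Re] by (simp add: o_def)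
  have I2: "((\<lambda>t. (norm (h (?\<gamma> t)))\<^sup>2) has_integral integral {0..1} (\<lambda>t. (norm (h (?\<gamma> t)))\<^sup>2)) {0..1}"
    by (intro integrable_integral integrable_circlepath[of "\<lambda>z. (norm (h z))\<^sup>2"] continuous_intros cont assms)
  have I3: "((\<lambda>t. (norm (c 0))\<^sup>2) has_integral (norm (c 0))\<^sup>2) {0..1::real}"
    using has_integral_const_real[of "(norm (c 0))\<^sup>2" 0 1] by simp
  have ng: "norm (?\<gamma> t) = r" for t
    using assms by (simp add: circlepath norm_mult)
  have eq: "(norm (f (?\<gamma> t)))\<^sup>2 = (norm (c 0))\<^sup>2 + 2 * Re (cnj (c 0) * (?\<gamma> t * h (?\<gamma> t))) + r\<^sup>2 * (norm (h (?\<gamma> t)))\<^sup>2" for t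
  proof -
    have "norm (?\<gamma> t) < 1" using assms ng by simp
    then have "(norm (f (?\<gamma> t)))\<^sup>2 = (norm (c 0 + ?\<gamma> t * h (?\<gamma> t)))\<^sup>2" by (simp add: fh)
    also have "\<dots> = (norm (c 0))\<^sup>2 + 2 * Re (cnj (c 0) * (?\<gamma> t * h (?\<gamma> t))) + (norm (?\<gamma> t * h (?\<gamma> t)))\<^sup>2"
      unfolding cmod_power2 by (simp add: power2_eq_square algebra_simps)
    finally show ?thesis by (simp add: norm_mult ng power_mult_distrib)
  qed
  have "((\<lambda>t. (norm (f (?\<gamma> t)))\<^sup>2) has_integral (norm (c 0))\<^sup>2 + 2 * 0 + r\<^sup>2 * integral {0..1} (\<lambda>t. (norm (h (?\<gamma> t)))\<^sup>2)) {0..1}"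
    unfolding eq by (intro has_integral_add has_integral_mult_right I1 I2 I3)
  then have "integral {0..1} (\<lambda>t. (norm (f (?\<gamma> t)))\<^sup>2) = (norm (c 0))\<^sup>2 + r\<^sup>2 * integral {0..1} (\<lambda>t. (norm (h (?\<gamma> t)))\<^sup>2)"
    by (simp add: integral_unique)
  moreover have "r\<^sup>2 * (\<Sum>m<K. (norm (c (Suc m)))\<^sup>2 * r ^ (2 * m)) \<le> r\<^sup>2 * integral {0..1} (\<lambda>t. (norm (h (?\<gamma> t)))\<^sup>2)"
    by (intro mult_left_mono Suc.IH hs) auto
  moreover have "(\<Sum>m<Suc K. (norm (c m))\<^sup>2 * r ^ (2 * m)) = (norm (c 0))\<^sup>2 + r\<^sup>2 * (\<Sum>m<K. (norm (c (Suc m)))\<^sup>2 * r ^ (2 * m))"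
    by (subst sum.lessThan_Suc_shift) (simp add: sum_distrib_left power2_eq_square mult_ac)
  ultimately show ?case by simp
qed

text \<open>The mean of \<open>Re G\<close> over every circle about the origin is
  \<open>Re (G 0)\<close>, independently of the radius, so Bessel's inequality survives the limit of
  radii tending to 1.\<close>

lemma coeffs_l2_le_majorant:
  assumes "\<And>z. norm z < 1 \<Longrightarrow> (\<lambda>m. c m * z ^ m) sums f z"
    and G: "G holomorphic_on ball 0 1"
    and le: "\<And>z. norm z < 1 \<Longrightarrow> (norm (f z))\<^sup>2 \<le> Re (G z)"
  shows "(\<Sum>m<K. (norm (c m))\<^sup>2) \<le> Re (G 0)"
proof -
  have f: "f holomorphic_on ball 0 1"
    by (rule power_series_holomorphic[where a = c]) (use assms(1) in simp)
  have "(\<Sum>m<K. (norm (c m))\<^sup>2 * r ^ (2 * m)) \<le> Re (G 0)" if r: "0 < r" "r < 1" for r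
  proof -
    let ?\<gamma> = "circlepath 0 r"
    have ng: "norm (?\<gamma> t) < 1" for t
      using r by (simp add: circlepath norm_mult)
    have "((\<lambda>t. Re (G (?\<gamma> t))) has_integral Re (G 0)) {0..1}"
      using has_integral_linear[OF mean_value_circlepath[OF G r] bounded_linear_Re] by (simp add: o_def)
    moreover have "(\<lambda>t. (norm (f (?\<gamma> t)))\<^sup>2) integrable_on {0..1}"
      by (intro integrable_circlepath[of "\<lambda>z. (norm (f z))\<^sup>2"] continuous_intros
          holomorphic_on_imp_continuous_on f r)
    ultimately have "integral {0..1} (\<lambda>t. (norm (f (?\<gamma> t)))\<^sup>2) \<le> Re (G 0)"
      by (meson has_integral_le integrable_integral le ng)
    with bessel_circlepath[OF assms(1) r] show ?thesis by (rule order_trans)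
  qed
  \<comment> \<open>Only finitely many coefficients occur, so the left side is a polynomial in the
    radius and the limit is immediate.\<close>
  then have "\<forall>\<^sub>F r in at_left 1. (\<Sum>m<K. (norm (c m))\<^sup>2 * r ^ (2 * m)) \<le> Re (G 0)"
    by (auto simp: eventually_at_left_field intro!: exI[of _ 0])
  moreover have "((\<lambda>r. \<Sum>m<K. (norm (c m))\<^sup>2 * r ^ (2 * m)) \<longlongrightarrow> (\<Sum>m<K. (norm (c m))\<^sup>2 * 1 ^ (2 * m))) (at_left 1)"
    by (intro tendsto_intros)
  ultimately have "(\<Sum>m<K. (norm (c m))\<^sup>2 * 1 ^ (2 * m)) \<le> Re (G 0)"
    by (intro tendsto_upperbound[of _ _ "at_left 1"]) (auto simp: trivial_limit_at_left_real)
  then show ?thesis by simp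
qed

text \<open>The zero function is its own majorant.\<close>

lemma powser_eq_0_imp_coeff_0:
  fixes c :: "nat \<Rightarrow> complex"
  assumes "\<And>z. norm z < 1 \<Longrightarrow> (\<lambda>m. c m * z ^ m) sums 0"
  shows "c m = 0"
proof -
  have "(\<Sum>m<Suc m. (norm (c m))\<^sup>2) \<le> Re 0"
    by (rule coeffs_l2_le_majorant[OF assms]) auto
  moreover have "(norm (c m))\<^sup>2 \<le> (\<Sum>m<Suc m. (norm (c m))\<^sup>2)"
    by (rule member_le_sum) auto
  ultimately have "(norm (c m))\<^sup>2 \<le> 0" by (metis order_trans zero_complex.sel(1))
  then show ?thesis by simp
qed

section \<open>Powers of a cusp map in the Hardy space of the disk\<close>

definition taylor_coeff :: "(complex \<Rightarrow> complex) \<Rightarrow> nat \<Rightarrow> complex" where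
  "taylor_coeff f m = (deriv ^^ m) f 0 / fact m"

text \<open>Defined through coefficients rather than boundary values. The series is meaningful once
  it converges, which a harmonic majorant, in particular a bound on \<open>f\<close>,
  guarantees.\<close>

definition hardy_norm :: "(complex \<Rightarrow> complex) \<Rightarrow> real" where
  "hardy_norm f = sqrt (\<Sum>m. (norm (taylor_coeff f m))\<^sup>2)"

lemma taylor_coeff_sums:
  assumes "f holomorphic_on ball 0 1" "norm z < 1"
  shows "(\<lambda>m. taylor_coeff f m * z ^ m) sums f z"
  using holomorphic_power_series[OF assms(1), of z] assms(2) by (simp add: taylor_coeff_def)

context
  fixes f G :: "complex \<Rightarrow> complex"
  assumes f: "f holomorphic_on ball 0 1" and G: "G holomorphic_on ball 0 1"
    and le: "\<And>z. norm z < 1 \<Longrightarrow> (norm (f z))\<^sup>2 \<le> Re (G z)"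
begin

lemma summable_taylor_coeff_majorant: "summable (\<lambda>m. (norm (taylor_coeff f m))\<^sup>2)"
proof (rule bounded_imp_summable[where B = "Re (G 0)"])
  show "(\<Sum>m\<le>K. (norm (taylor_coeff f m))\<^sup>2) \<le> Re (G 0)" for K
    unfolding lessThan_Suc_atMost[symmetric]
    by (rule coeffs_l2_le_majorant[OF taylor_coeff_sums[OF f] G le])
qed simp

lemma hardy_norm_le_majorant: "(hardy_norm f)\<^sup>2 \<le> Re (G 0)"
  using suminf_le_const[OF summable_taylor_coeff_majorant, of "Re (G 0)"]
    suminf_nonneg[OF summable_taylor_coeff_majorant]
    coeffs_l2_le_majorant[OF taylor_coeff_sums[OF f] G le]
  by (simp add: hardy_norm_def)

end

context
  fixes f :: "complex \<Rightarrow> complex"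
  assumes f: "f holomorphic_on ball 0 1" and le: "\<And>z. norm z < 1 \<Longrightarrow> norm (f z) \<le> 1"
begin

lemma summable_taylor_coeff: "summable (\<lambda>m. (norm (taylor_coeff f m))\<^sup>2)"
  by (rule summable_taylor_coeff_majorant[OF f, of "\<lambda>_. 1"])
    (use le in \<open>auto simp: abs_square_le_1\<close>)

lemma hardy_norm_nonneg: "hardy_norm f \<ge> 0"
  using suminf_nonneg[OF summable_taylor_coeff] by (simp add: hardy_norm_def)

lemma taylor_coeff_has_sum: "((\<lambda>m. (norm (taylor_coeff f m))\<^sup>2) has_sum (hardy_norm f)\<^sup>2) UNIV"
proof -
  have "(hardy_norm f)\<^sup>2 = (\<Sum>m. (norm (taylor_coeff f m))\<^sup>2)"
    using suminf_nonneg[OF summable_taylor_coeff] by (simp add: hardy_norm_def)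
  then show ?thesis
    using summable_sums[OF summable_taylor_coeff] by (intro sums_nonneg_imp_has_sum) auto
qed

text \<open>Cauchy-Schwarz against the geometric series: 1 / (1 - |z|^2) is the squared norm of
  evaluation at \<open>z\<close>. This is the source of all lower bounds for Hardy norms.\<close>

lemma norm_le_hardy_norm:
  assumes z: "norm z < 1"
  shows "(norm (f z))\<^sup>2 * (1 - (norm z)\<^sup>2) \<le> (hardy_norm f)\<^sup>2"
proof -
  have z2: "(norm z)\<^sup>2 < 1" using z by (simp add: abs_square_less_1)
  have S: "(\<lambda>m. ((norm z)\<^sup>2) ^ m) sums (1 / (1 - (norm z)\<^sup>2))"
    by (rule geometric_sums) (use z2 in simp)
  have T: "(\<lambda>m. (norm (taylor_coeff f m))\<^sup>2) sums (hardy_norm f)\<^sup>2"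
    using taylor_coeff_has_sum by (rule has_sum_imp_sums)
  have "(norm (\<Sum>m<K. taylor_coeff f m * z ^ m))\<^sup>2 \<le> (hardy_norm f)\<^sup>2 * (1 / (1 - (norm z)\<^sup>2))" for K
  proof -
    have "norm (\<Sum>m<K. taylor_coeff f m * z ^ m) \<le> (\<Sum>m<K. norm (taylor_coeff f m) * norm z ^ m)"
      by (rule order_trans[OF norm_sum]) (simp add: norm_mult norm_power)
    then have "(norm (\<Sum>m<K. taylor_coeff f m * z ^ m))\<^sup>2 \<le> (\<Sum>m<K. norm (taylor_coeff f m) * norm z ^ m)\<^sup>2"
      by (rule power_mono) simp
    also have "\<dots> \<le> (\<Sum>m<K. (norm (taylor_coeff f m))\<^sup>2) * (\<Sum>m<K. (norm z ^ m)\<^sup>2)"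
      by (rule Cauchy_Schwarz_ineq_sum)
    also have "(\<lambda>m. (norm z ^ m)\<^sup>2) = (\<lambda>m. ((norm z)\<^sup>2) ^ m)"
      by (simp add: power_mult[symmetric] mult.commute)
    also have "(\<Sum>m<K. (norm (taylor_coeff f m))\<^sup>2) * (\<Sum>m<K. ((norm z)\<^sup>2) ^ m) \<le> (hardy_norm f)\<^sup>2 * (1 / (1 - (norm z)\<^sup>2))"
      unfolding sums_unique[OF S] sums_unique[OF T]
      using S T by (intro mult_mono sum_le_suminf) (auto simp: sums_iff intro!: suminf_nonneg sum_nonneg)
    finally show ?thesis .
  qed
  moreover have "(\<lambda>K. (norm (\<Sum>m<K. taylor_coeff f m * z ^ m))\<^sup>2) \<longlonglongrightarrow> (norm (f z))\<^sup>2"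
    using taylor_coeff_sums[OF f z] unfolding sums_def by (intro tendsto_intros)
  ultimately have "(norm (f z))\<^sup>2 \<le> (hardy_norm f)\<^sup>2 * (1 / (1 - (norm z)\<^sup>2))"
    by (intro LIMSEQ_le_const2) auto
  with z2 show ?thesis by (simp add: field_simps)
qed

lemma hardy_norm_le_1: "hardy_norm f \<le> 1"
proof -
  have "(hardy_norm f)\<^sup>2 \<le> Re 1"
    by (rule hardy_norm_le_majorant[OF f, of "\<lambda>_. 1"]) (use le in \<open>auto simp: abs_square_le_1\<close>)
  then show ?thesis using hardy_norm_nonneg by (simp add: abs_square_le_1)
qed

end

section \<open>The cusp map and two-sided estimates for its powers\<close>

definition log_cusp :: "real \<Rightarrow> complex \<Rightarrow> complex" where
  "log_cusp p z = of_real (2 * p + 1) - Ln (1 - z)"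

definition cusp :: "real \<Rightarrow> complex \<Rightarrow> complex" where
  "cusp p z = exp (- (log_cusp p z powr of_real (- p)))"

text \<open>The argument of \<open>w\<close> is at most (pi / 2) / (2 * p), so raising to the power
  -p turns it by at most pi / 4, well inside the sector of half-angle pi / 3 where the real part is
  at least half the modulus. This explains the constant in \<open>log_cusp\<close>:
  \<open>2 * p\<close> provides the narrow sector and the additional 1 absorbs ln |1 - z| \<le> ln
  2.\<close>

lemma Re_powr_ge_half:
  assumes "Re w \<ge> 2 * p" "\<bar>Im w\<bar> \<le> pi / 2" "p > 0"
  shows "Re (w powr of_real (- p)) \<ge> norm w powr (- p) / 2"
proof -
  have w: "w \<noteq> 0" "Re w > 0" using assms by auto
  have "Im (Ln w) = arctan (Im w / Re w)"
    using w by (simp add: Arg_eq_Im_Ln[symmetric] arg_conv_arctan)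
  then have "\<bar>Im (Ln w)\<bar> \<le> \<bar>Im w / Re w\<bar>"
    using abs_arctan_le[of "Im w / Re w"] by metis
  also have "\<dots> \<le> (pi / 2) / (2 * p)"
    unfolding abs_divide using assms w by (intro frac_le) auto
  finally have "p * \<bar>Im (Ln w)\<bar> \<le> p * ((pi / 2) / (2 * p))"
    using assms by (intro mult_left_mono) auto
  also have "\<dots> \<le> pi / 3" using assms by (simp add: field_simps)
  finally have "cos (pi / 3) \<le> cos \<bar>p * Im (Ln w)\<bar>"
    using assms by (intro cos_monotone_0_pi_le) (auto simp: abs_mult)
  then have "cos (p * Im (Ln w)) \<ge> 1 / 2" by (simp add: cos_60)
  moreover have "Re (w powr of_real (- p)) = norm w powr (- p) * cos (p * Im (Ln w))"
    using w by (simp add: powr_def Re_exp)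
  ultimately show ?thesis
    using mult_left_mono[of "1/2" "cos (p * Im (Ln w))" "norm w powr (- p)"] by simp
qed

context
  fixes p :: real
  assumes p: "p > 0"
begin

lemma log_cusp_bounds:
  assumes "norm z < 1"
  shows "Re (log_cusp p z) = 2 * p + 1 - ln (norm (1 - z))" "Re (log_cusp p z) \<ge> 2 * p"
    "\<bar>Im (log_cusp p z)\<bar> \<le> pi / 2"
proof -
  have "Re z < 1" using assms abs_Re_le_cmod[of z] by linarith
  then have z: "1 - z \<noteq> 0" "Re (1 - z) > 0" by (auto simp: complex_eq_iff)
  show 1: "Re (log_cusp p z) = 2 * p + 1 - ln (norm (1 - z))"
    using z by (simp add: log_cusp_def)
  show "\<bar>Im (log_cusp p z)\<bar> \<le> pi / 2"
    using Re_Ln_pos_lt[OF z(1)] z by (simp add: log_cusp_def)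
  have "norm (1 - z) \<le> 2" using norm_triangle_ineq4[of 1 z] assms by simp
  then have "ln (norm (1 - z)) \<le> ln 2" using z by simp
  with ln_2_less_1 show "Re (log_cusp p z) \<ge> 2 * p" unfolding 1 by linarith
qed

lemma log_cusp_powr_ge:
  assumes "norm z < 1"
  shows "Re (log_cusp p z powr of_real (- p)) \<ge> norm (log_cusp p z) powr (- p) / 2"
  using log_cusp_bounds[OF assms] p by (intro Re_powr_ge_half) auto

lemma log_cusp_not_nonpos:
  assumes "norm z < 1"
  shows "log_cusp p z \<notin> \<real>\<^sub>\<le>\<^sub>0"
  using log_cusp_bounds(2)[OF assms] p by (auto simp: complex_nonpos_Reals_iff)

lemma holomorphic_cusp: "cusp p holomorphic_on ball 0 1"
proof -
  have "1 - z \<notin> \<real>\<^sub>\<le>\<^sub>0" if "norm z < 1" for z :: complex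
    using that abs_Re_le_cmod[of z] by (auto simp: complex_nonpos_Reals_iff)
  then have "log_cusp p holomorphic_on ball 0 1"
    unfolding log_cusp_def by (intro holomorphic_intros) auto
  then show ?thesis
    unfolding cusp_def using log_cusp_not_nonpos by (intro holomorphic_intros) auto
qed

lemma norm_cusp_power: "norm (cusp p z ^ k) = exp (- (real k * Re (log_cusp p z powr of_real (- p))))"
  by (simp add: cusp_def norm_power exp_of_nat_mult[symmetric])

lemma norm_cusp_less_1:
  assumes "norm z < 1"
  shows "norm (cusp p z) < 1"
proof -
  have "norm (log_cusp p z) powr (- p) > 0"
    using log_cusp_not_nonpos[OF assms] by auto
  with log_cusp_powr_ge[OF assms] have "Re (log_cusp p z powr of_real (- p)) > 0" by linarith
  with norm_cusp_power[of z 1] show ?thesis by simp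
qed

lemma norm_cusp_power_le_1: "norm z < 1 \<Longrightarrow> norm (cusp p z ^ k) \<le> 1"
  using norm_cusp_less_1[of z] by (simp add: norm_power power_le_one)

text \<open>Along this radius the logarithm is real and affine in \<open>x\<close>, where exp (-x)
  is the distance to the boundary point 1.\<close>

lemma cusp_real:
  assumes "x \<ge> 0"
  shows "cusp p (of_real (1 - exp (- x))) = of_real (exp (- ((2 * p + 1 + x) powr (- p))))"
proof -
  have "log_cusp p (of_real (1 - exp (- x))) = of_real (2 * p + 1 + x)"
    by (simp add: log_cusp_def Ln_of_real)
  moreover have "of_real (2 * p + 1 + x) powr of_real (- p) = (of_real ((2 * p + 1 + x) powr (- p)) :: complex)"
    by (rule powr_of_real) (use p assms in auto)
  ultimately show ?thesis unfolding cusp_def by (metis exp_of_real of_real_minus)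
qed

text \<open>Evaluation at the point at distance exp (-x) from 1, with \<open>x\<close> chosen so
  that x^(p+1) = k. Of the constant 3, a share of 2 is the squared modulus of the power and 1 is the
  loss 1 - |z|^2 of the point evaluation.\<close>

lemma hardy_norm_cusp_power_ge:
  "(hardy_norm (\<lambda>z. cusp p z ^ k))\<^sup>2 \<ge> exp (- 3 * real k powr (1 / (p + 1)))"
proof -
  define x where "x = real k powr (1 / (p + 1))"
  let ?r = "1 - exp (- x)"
  have x: "x \<ge> 0" by (simp add: x_def)
  then have r: "0 \<le> ?r" "?r < 1" by auto
  then have nr: "norm (of_real ?r :: complex) = ?r" by (simp del: of_real_diff)
  have kx: "real k * (2 * p + 1 + x) powr (- p) \<le> x"
  proof (cases "k = 0")
    case False
    have "real k * (2 * p + 1 + x) powr (- p) \<le> real k * x powr (- p)"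
      using False p by (intro mult_left_mono powr_mono2') (auto simp: x_def)
    also have "\<dots> = real k powr 1 * real k powr (- p / (p + 1))"
      using False by (simp add: x_def powr_powr)
    also have "\<dots> = real k powr (1 + - p / (p + 1))" by (simp only: powr_add)
    also have "1 + - p / (p + 1) = 1 / (p + 1)" using p by (simp add: field_simps)
    finally show ?thesis by (simp add: x_def)
  qed (use x in simp)
  have "exp (- 3 * x) = exp (- 2 * x) * exp (- x)" by (simp add: exp_add[symmetric])
  also have "\<dots> \<le> (norm (cusp p (of_real ?r) ^ k))\<^sup>2 * (1 - ?r\<^sup>2)"
  proof (intro mult_mono)
    have "(norm (cusp p (of_real ?r) ^ k))\<^sup>2 = exp (- 2 * (real k * (2 * p + 1 + x) powr (- p)))"
      unfolding cusp_real[OF x]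
      by (simp add: norm_power exp_of_nat_mult[symmetric] power_mult[symmetric] exp_double[symmetric])
    then show "exp (- 2 * x) \<le> (norm (cusp p (of_real ?r) ^ k))\<^sup>2" using kx by simp
    have "?r\<^sup>2 \<le> ?r" using r by (simp add: power2_eq_square mult_left_le)
    then show "exp (- x) \<le> 1 - ?r\<^sup>2" by simp
  qed auto
  also have "\<dots> \<le> (hardy_norm (\<lambda>z. cusp p z ^ k))\<^sup>2"
    using norm_le_hardy_norm[of "\<lambda>z. cusp p z ^ k" "of_real ?r"] r nr norm_cusp_power_le_1
    by (simp add: holomorphic_on_power holomorphic_cusp del: of_real_diff)
  finally show ?thesis by (simp add: x_def)
qed

text \<open>The disk is split at |1 - z| = exp (-x). Far from 1 the power is uniformly small; near 1
  it is bounded only by 1, but that region has small harmonic measure seen from the origin. The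
  constant 3 is 1 for the far part plus 2 for the value of the kernel term at 0.\<close>

lemma hardy_norm_cusp_power_le:
  "(hardy_norm (\<lambda>z. cusp p z ^ k))\<^sup>2 \<le> 3 * exp (- ((2 * p + 4) powr (- p) * real k powr (1 / (p + 1))))"
proof (cases "k = 0")
  case True
  have "hardy_norm (\<lambda>z. cusp p z ^ k) \<le> 1" "hardy_norm (\<lambda>z. cusp p z ^ k) \<ge> 0"
    by (intro hardy_norm_le_1 hardy_norm_nonneg holomorphic_on_power holomorphic_cusp norm_cusp_power_le_1; simp)+
  then have "(hardy_norm (\<lambda>z. cusp p z ^ k))\<^sup>2 \<le> 1" by (simp add: abs_square_le_1)
  with True show ?thesis by simp
next
  case False
  define x where "x = real k powr (1 / (p + 1))"
  define a where "a = (2 * p + 4) powr (- p)"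
  define \<delta> where "\<delta> = exp (- x)"
  \<comment> \<open>The second summand is a multiple of a Poisson kernel that is at least \<open>1\<close> on \<open>|1 - z| < \<delta>\<close>, where the cusp map
    is close to the unit circle, but only \<open>2 * \<delta>\<close> at the origin.\<close>
  define G where "G z = of_real (exp (- a * x)) + of_real (2 * \<delta>) * ((of_real (1 + \<delta>) + z) / (of_real (1 + \<delta>) - z))" for z :: complex
  \<comment> \<open>This fails for \<open>k = 0\<close>, hence the separate case. It is what allows
    \<open>2 * p + 3 + x\<close> to be replaced by the multiple \<open>(2 * p + 4) * x\<close>, from
    which \<open>a\<close> arises.\<close>
  have x: "x \<ge> 1" using False p by (simp add: x_def ge_one_powr_ge_zero)
  have \<delta>: "\<delta> > 0" by (simp add: \<delta>_def)
  have a: "a \<le> 1" "a > 0" using p powr_mono2'[of "-p" 1 "2 * p + 4"] by (auto simp: a_def)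
  have ne: "of_real (1 + \<delta>) - z \<noteq> 0" if "norm z < 1" for z :: complex
  proof
    assume "of_real (1 + \<delta>) - z = 0"
    then have "norm z = norm (of_real (1 + \<delta>) :: complex)" by simp
    with that \<delta> show False unfolding norm_of_real by simp
  qed
  have kx: "real k * (2 * p + 3 + x) powr (- p) \<ge> a * x"
  proof -
    have "x powr (p + 1) = real k" using False p by (simp add: x_def powr_powr)
    then have "a * x = real k * (a * x powr (- p))"
      using x by (simp add: powr_add powr_minus field_simps)
    also have "a * x powr (- p) = ((2 * p + 4) * x) powr (- p)"
      using p x by (simp add: a_def powr_mult)
    also have "\<dots> \<le> (2 * p + 3 + x) powr (- p)"
    proof (rule powr_mono2')
      have "(2 * p + 3) * 1 \<le> (2 * p + 3) * x" using p x by (intro mult_left_mono) auto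
      then show "2 * p + 3 + x \<le> (2 * p + 4) * x" by (simp add: algebra_simps)
    qed (use p x in auto)
    finally show ?thesis by (simp add: mult_left_mono)
  qed
  have "(norm (cusp p z ^ k))\<^sup>2 \<le> Re (G z)" if z: "norm z < 1" for z
  proof -
    have v: "Re ((of_real (1 + \<delta>) + z) / (of_real (1 + \<delta>) - z)) = ((1 + \<delta>)\<^sup>2 - (norm z)\<^sup>2) / (norm (of_real (1 + \<delta>) - z))\<^sup>2"
      unfolding Re_divide cmod_power2 by (simp add: power2_eq_square algebra_simps)
    have num: "(1 + \<delta>)\<^sup>2 - (norm z)\<^sup>2 \<ge> 2 * \<delta>"
    proof -
      have "(norm z)\<^sup>2 \<le> 1" using z by (simp add: abs_square_le_1)
      moreover have "(1 + \<delta>)\<^sup>2 = 1 + 2 * \<delta> + \<delta>\<^sup>2" by (simp add: power2_sum)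
      ultimately show ?thesis using zero_le_power2[of \<delta>] by linarith
    qed
    have ReG: "Re (G z) = exp (- a * x) + 2 * \<delta> * (((1 + \<delta>)\<^sup>2 - (norm z)\<^sup>2) / (norm (of_real (1 + \<delta>) - z))\<^sup>2)"
    proof -
      have "Re (of_real A + of_real B * w) = A + B * Re w" for A B w by simp
      from this[of "exp (- a * x)" "2 * \<delta>"] show ?thesis unfolding G_def v[symmetric] .
    qed
    show ?thesis
    proof (cases "norm (1 - z) \<ge> \<delta>")
      case True
      have "ln \<delta> \<le> ln (norm (1 - z))" using True \<delta> by (subst ln_le_cancel_iff) linarith+
      then have "Re (log_cusp p z) \<le> 2 * p + 1 + x"
        unfolding log_cusp_bounds(1)[OF z] by (simp add: \<delta>_def)
      \<comment> \<open>The imaginary part, at most pi / 2, raises the constant from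
        \<open>2 * p + 1\<close> to \<open>2 * p + 3\<close>.\<close>
      moreover have "\<bar>Im (log_cusp p z)\<bar> \<le> 2" using log_cusp_bounds(3)[OF z] pi_less_4 by linarith
      ultimately have "norm (log_cusp p z) \<le> 2 * p + 3 + x"
        using cmod_le[of "log_cusp p z"] log_cusp_bounds(2)[OF z] p by linarith
      then have "(2 * p + 3 + x) powr (- p) \<le> norm (log_cusp p z) powr (- p)"
        using p log_cusp_not_nonpos[OF z] by (intro powr_mono2') auto
      also have "\<dots> \<le> 2 * Re (log_cusp p z powr of_real (- p))"
        using log_cusp_powr_ge[OF z] by simp
      finally have "real k * (2 * p + 3 + x) powr (- p) \<le> real k * (2 * Re (log_cusp p z powr of_real (- p)))"
        by (rule mult_left_mono) simp
      with kx have "a * x \<le> 2 * (real k * Re (log_cusp p z powr of_real (- p)))" by simp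
      \<comment> \<open>The square of the modulus cancels the factor 1/2 lost in the sector
        estimate.\<close>
      then have "(norm (cusp p z ^ k))\<^sup>2 \<le> exp (- a * x)"
        unfolding norm_cusp_power exp_double[symmetric] by simp
      also have "\<dots> \<le> Re (G z)" unfolding ReG using num \<delta> z
        by (intro add_increasing2 mult_nonneg_nonneg divide_nonneg_nonneg) auto
      finally show ?thesis .
    next
      case False
      \<comment> \<open>The pole \<open>1 + \<delta>\<close> lies within \<open>2 * \<delta>\<close>
        of \<open>z\<close>, and the numerator of the kernel is at least
        \<open>2 * \<delta>\<close>, so the kernel is at least 1 / (2 \<delta>).\<close>
      have "norm (of_real (1 + \<delta>) - z) = norm ((1 - z) + of_real \<delta>)" by (simp add: algebra_simps)
      also have "\<dots> \<le> 2 * \<delta>" using norm_triangle_ineq[of "1 - z" "of_real \<delta>"] False \<delta> by simp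
      finally have "(norm (of_real (1 + \<delta>) - z))\<^sup>2 \<le> (2 * \<delta>)\<^sup>2" by (rule power_mono) simp
      then have "2 * \<delta> / (2 * \<delta>)\<^sup>2 \<le> ((1 + \<delta>)\<^sup>2 - (norm z)\<^sup>2) / (norm (of_real (1 + \<delta>) - z))\<^sup>2"
        using num \<delta> z ne[OF z] by (intro frac_le) auto
      then have "2 * \<delta> * (2 * \<delta> / (2 * \<delta>)\<^sup>2) \<le> 2 * \<delta> * (((1 + \<delta>)\<^sup>2 - (norm z)\<^sup>2) / (norm (of_real (1 + \<delta>) - z))\<^sup>2)"
        using \<delta> by (intro mult_left_mono) auto
      also have "2 * \<delta> * (2 * \<delta> / (2 * \<delta>)\<^sup>2) = 1" using \<delta> by (simp add: power2_eq_square)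
      finally have "1 \<le> Re (G z)" unfolding ReG using exp_gt_zero[of "- a * x"] by linarith
      moreover have "(norm (cusp p z ^ k))\<^sup>2 \<le> 1"
        using norm_cusp_power_le_1[OF z, of k] by (simp add: abs_square_le_1)
      ultimately show ?thesis by linarith
    qed
  qed
  moreover have "G holomorphic_on ball 0 1"
    unfolding G_def using ne by (intro holomorphic_intros) auto
  ultimately have "(hardy_norm (\<lambda>z. cusp p z ^ k))\<^sup>2 \<le> Re (G 0)"
    by (intro hardy_norm_le_majorant holomorphic_on_power holomorphic_cusp)
  also have "G 0 = of_real (exp (- a * x) + 2 * \<delta>)"
    using ne[of 0] by (simp add: G_def)
  also have "Re \<dots> \<le> 3 * exp (- a * x)"
    using mult_right_mono[OF a(1), of x] x by (simp add: \<delta>_def)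
  finally show ?thesis by (simp add: a_def x_def)
qed

end

section \<open>Taylor coefficients on the polydisk\<close>

text \<open>Unconditional summation may be regrouped along the fibres of \<open>\<phi>\<close>, and
  finite fibres make the inner sums ordinary finite sums. A family of monomials thereby becomes a
  one-variable power series.\<close>

lemma has_sum_group_powser:
  fixes d :: "'a \<Rightarrow> 'b::real_normed_field"
  assumes fin: "\<And>m. finite {x\<in>I. \<phi> x = m}"
    and sum: "((\<lambda>x. d x * s ^ \<phi> x) has_sum F) I"
  shows "((\<lambda>m. (\<Sum>x\<in>{x\<in>I. \<phi> x = m}. d x) * s ^ m) has_sum F) UNIV"
proof -
  let ?h = "\<lambda>x. (\<phi> x, x)"
  have "((\<lambda>(m, x). d x * s ^ m) has_sum F) (?h ` I)"
    by (subst has_sum_reindex) (use sum in \<open>auto simp: o_def inj_on_def\<close>)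
  also have "?h ` I = Sigma UNIV (\<lambda>m. {x\<in>I. \<phi> x = m})" by auto
  finally show ?thesis
    by (rule has_sum_SigmaD) (auto intro!: has_sum_finiteI fin simp: sum_distrib_right)
qed

lemma powser_group_eq_0:
  fixes d :: "'a \<Rightarrow> complex"
  assumes "\<And>m. finite {x\<in>I. \<phi> x = m}"
    and "\<And>s. norm s < 1 \<Longrightarrow> ((\<lambda>x. d x * s ^ \<phi> x) has_sum 0) I"
  shows "(\<Sum>x\<in>{x\<in>I. \<phi> x = m}. d x) = 0"
  using powser_eq_0_imp_coeff_0[of "\<lambda>m. \<Sum>x\<in>{x\<in>I. \<phi> x = m}. d x"]
    has_sum_imp_sums[OF has_sum_group_powser[OF assms]] by blast

lemma finite_multiindices: "finite {\<alpha> :: 'n::finite \<Rightarrow> nat. sum \<alpha> UNIV = m}"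
  and card_multiindices: "card {\<alpha> :: 'n \<Rightarrow> nat. sum \<alpha> UNIV = m} \<le> (m + 1) ^ CARD('n)"
proof -
  have sub: "{\<alpha> :: 'n \<Rightarrow> nat. sum \<alpha> UNIV = m} \<subseteq> PiE UNIV (\<lambda>_. {..m})"
    by (auto simp: member_le_sum)
  then show "finite {\<alpha> :: 'n \<Rightarrow> nat. sum \<alpha> UNIV = m}"
    by (rule finite_subset) (auto intro: finite_PiE)
  have "card {\<alpha> :: 'n \<Rightarrow> nat. sum \<alpha> UNIV = m} \<le> card (PiE (UNIV :: 'n set) (\<lambda>_. {..m}))"
    by (rule card_mono[OF _ sub]) (auto intro: finite_PiE)
  then show "card {\<alpha> :: 'n \<Rightarrow> nat. sum \<alpha> UNIV = m} \<le> (m + 1) ^ CARD('n)"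
    by (simp add: card_PiE)
qed

text \<open>Makes the Kronecker substitution injective: the exponents of a monomial are read off as
  the digits of a single number.\<close>

lemma base_digits_unique:
  fixes a b :: "nat \<Rightarrow> nat"
  assumes "\<And>t. t < N \<Longrightarrow> a t < K \<and> b t < K" "(\<Sum>t<N. a t * K ^ t) = (\<Sum>t<N. b t * K ^ t)" "t < N"
  shows "a t = b t"
  using assms
proof (induction N arbitrary: a b t)
  case (Suc N)
  have split: "(\<Sum>t<Suc N. f t * K ^ t) = f 0 + K * (\<Sum>t<N. f (Suc t) * K ^ t)" for f :: "nat \<Rightarrow> nat"
    by (subst sum.lessThan_Suc_shift) (simp add: sum_distrib_left mult_ac)
  have eq: "a 0 + K * (\<Sum>t<N. a (Suc t) * K ^ t) = b 0 + K * (\<Sum>t<N. b (Suc t) * K ^ t)"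
    using Suc.prems(2) split[of a] split[of b] by argo
  have lt: "a 0 < K" "b 0 < K" using Suc.prems(1) by auto
  have 0: "a 0 = b 0" using arg_cong[OF eq, of "\<lambda>n. n mod K"] lt by (metis mod_less mod_mult_self2)
  have "(\<Sum>t<N. a (Suc t) * K ^ t) = (\<Sum>t<N. b (Suc t) * K ^ t)" using eq 0 lt by simp
  then have "\<And>t. t < N \<Longrightarrow> a (Suc t) = b (Suc t)"
    by (rule Suc.IH[rotated]) (use Suc.prems(1) in auto)
  with 0 Suc.prems(3) show ?case by (cases t) auto
qed simp

lemma monom_scale: "monom (\<chi> x. s * w $ x) \<alpha> = s ^ sum \<alpha> UNIV * monom w \<alpha>"
  by (simp add: monom_def power_mult_distrib prod.distrib power_sum)

text \<open>Grouping by degree isolates the homogeneous parts; the Kronecker substitution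
  \<open>z\<^sub>i = s ^ K ^ e i\<close> then separates the monomials of a fixed degree below \<open>K\<close>.\<close>
lemma has_coeffs_0_imp_0:
  fixes d :: "('n::finite \<Rightarrow> nat) \<Rightarrow> complex"
  assumes "has_coeffs (\<lambda>_. 0) d"
  shows "d \<beta> = 0"
proof -
  \<comment> \<open>No entry of an index with the degree of \<open>\<beta>\<close> exceeds that
    degree, so all entries are base-\<open>K\<close> digits.\<close>
  define K where "K = Suc (sum \<beta> UNIV)"
  obtain e :: "'n \<Rightarrow> nat" where e: "bij_betw e UNIV {..<CARD('n)}"
    using ex_bij_betw_finite_nat[of "UNIV :: 'n set"] by (auto simp: atLeast0LessThan)
  define W where "W \<alpha> = (\<Sum>x\<in>UNIV. \<alpha> x * K ^ e x)" for \<alpha> :: "'n \<Rightarrow> nat"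
  let ?I = "{\<alpha> :: 'n \<Rightarrow> nat. sum \<alpha> UNIV = sum \<beta> UNIV}"
  have hom: "(\<Sum>\<alpha>\<in>{\<alpha>\<in>UNIV. sum \<alpha> UNIV = m}. d \<alpha> * monom w \<alpha>) = 0" if w: "w \<in> polydisk" for w m
  proof (rule powser_group_eq_0)
    fix s :: complex assume s: "norm s < 1"
    have "norm (s * w $ x) < 1" for x
    proof -
      have "norm (w $ x) < 1" using w by (simp add: polydisk_def)
      then have "norm s * norm (w $ x) < 1 * 1" using s by (intro mult_strict_mono') auto
      then show ?thesis by (simp add: norm_mult)
    qed
    then have "(\<chi> x. s * w $ x) \<in> polydisk" by (simp add: polydisk_def)
    then have "((\<lambda>\<alpha>. d \<alpha> * monom (\<chi> x. s * w $ x) \<alpha>) has_sum 0) UNIV"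
      using assms unfolding has_coeffs_def by blast
    then show "((\<lambda>\<alpha>. d \<alpha> * monom w \<alpha> * s ^ sum \<alpha> UNIV) has_sum 0) UNIV"
      by (simp add: monom_scale mult_ac)
  qed (simp add: finite_multiindices)
  have "(\<Sum>\<alpha>\<in>{\<alpha>\<in>?I. W \<alpha> = W \<beta>}. d \<alpha>) = 0"
  proof (rule powser_group_eq_0)
    fix s :: complex assume s: "norm s < 1"
    define w where "w = (\<chi> x. s ^ K ^ e x)"
    have "w \<in> polydisk"
      using s by (auto simp: w_def polydisk_def norm_power K_def intro!: power_less_one_iff[THEN iffD2])
    moreover have "monom w \<alpha> = s ^ W \<alpha>" for \<alpha>
      by (simp add: monom_def w_def W_def power_sum power_mult[symmetric] mult.commute)
    ultimately have "(\<Sum>\<alpha>\<in>?I. d \<alpha> * s ^ W \<alpha>) = 0" using hom[of w "sum \<beta> UNIV"] by simp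
    then show "((\<lambda>\<alpha>. d \<alpha> * s ^ W \<alpha>) has_sum 0) ?I"
      by (intro has_sum_finiteI) (auto simp: finite_multiindices)
  qed (simp add: finite_multiindices)
  also have "{\<alpha>\<in>?I. W \<alpha> = W \<beta>} = {\<beta>}"
  proof (intro equalityI subsetI)
    fix \<alpha> assume \<alpha>: "\<alpha> \<in> {\<alpha>\<in>?I. W \<alpha> = W \<beta>}"
    let ?g = "inv_into UNIV e"
    have W: "W \<gamma> = (\<Sum>t<CARD('n). \<gamma> (?g t) * K ^ t)" for \<gamma>
      unfolding W_def using e by (intro sum.reindex_bij_witness[of _ ?g e])
        (auto simp: bij_betw_def f_inv_into_f)
    have lt: "\<gamma> x < K" if "sum \<gamma> UNIV = sum \<beta> UNIV" for \<gamma> :: "'n \<Rightarrow> nat" and x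
      using that member_le_sum[of x UNIV \<gamma>] by (simp add: K_def less_Suc_eq_le)
    have "\<alpha> x = \<beta> x" for x
    proof -
      have "\<alpha> (?g (e x)) = \<beta> (?g (e x))"
        by (rule base_digits_unique[of "CARD('n)" "\<lambda>t. \<alpha> (?g t)" K "\<lambda>t. \<beta> (?g t)"])
          (use \<alpha> lt W e in \<open>auto simp: bij_betw_def\<close>)
      then show ?thesis using e by (simp add: bij_betw_def)
    qed
    then show "\<alpha> \<in> {\<beta>}" by auto
  qed simp
  finally show ?thesis by simp
qed

section \<open>Uniqueness of the coefficients and computation of norms\<close>

lemma has_coeffs_add:
  assumes "has_coeffs f a" "has_coeffs g b"
  shows "has_coeffs (\<lambda>z. f z + g z) (\<lambda>\<alpha>. a \<alpha> + b \<alpha>)"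
  using assms unfolding has_coeffs_def by (auto simp: distrib_right intro!: has_sum_add)

lemma has_coeffs_mult:
  assumes "has_coeffs f a"
  shows "has_coeffs (\<lambda>z. r * f z) (\<lambda>\<alpha>. r * a \<alpha>)"
  using assms unfolding has_coeffs_def by (auto simp: mult.assoc intro!: has_sum_cmult_right)

lemma has_coeffs_unique:
  assumes "has_coeffs f a" "has_coeffs f b"
  shows "a = b"
proof
  fix \<alpha>
  have "has_coeffs (\<lambda>z. f z + (- 1) * f z) (\<lambda>\<alpha>. a \<alpha> + (- 1) * b \<alpha>)"
    by (intro has_coeffs_add has_coeffs_mult assms)
  then show "a \<alpha> = b \<alpha>" using has_coeffs_0_imp_0[of "\<lambda>\<alpha>. a \<alpha> + (- 1) * b \<alpha>" \<alpha>] by simp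
qed

text \<open>Uniqueness gives the choice in \<open>h2coef\<close> its value; from here on, any
  expansion that can be exhibited computes the norm.\<close>

lemma h2coef_eqI: "has_coeffs f a \<Longrightarrow> h2coef f = a"
  unfolding h2coef_def by (rule some_equality) (auto intro: has_coeffs_unique)

lemma h2norm_eqI:
  assumes "has_coeffs f a" "((\<lambda>\<alpha>. (norm (a \<alpha>))\<^sup>2) has_sum T) UNIV"
  shows "f \<in> H2" "h2norm f = sqrt T"
  using assms by (auto simp: H2_def h2norm_def h2coef_eqI has_sum_iff)

lemma H2_has_coeffs: "f \<in> H2 \<Longrightarrow> has_coeffs f (h2coef f)"
  by (auto simp: H2_def h2coef_eqI)

lemma H2_has_sum: "f \<in> H2 \<Longrightarrow> ((\<lambda>\<alpha>. (norm (h2coef f \<alpha>))\<^sup>2) has_sum (h2norm f)\<^sup>2) UNIV"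
  by (auto simp: H2_def h2coef_eqI h2norm_def has_sum_iff infsum_nonneg)

lemma h2norm_nonneg: "f \<in> H2 \<Longrightarrow> h2norm f \<ge> 0"
  by (simp add: h2norm_def infsum_nonneg)

section \<open>Expansions in two of the coordinates\<close>

definition two_index :: "'n::finite \<Rightarrow> 'n \<Rightarrow> nat \<times> nat \<Rightarrow> 'n \<Rightarrow> nat" where
  "two_index i j = (\<lambda>(k, m) x. if x = j then k else if x = i then m else 0)"

context
  fixes i j :: "'n::finite"
  assumes ij: "i \<noteq> j"
begin

lemma inj_two_index: "inj (two_index i j)"
proof (rule injI)
  fix u v assume "two_index i j u = two_index i j v"
  from fun_cong[OF this, of i] fun_cong[OF this, of j] ij show "u = v"
    by (auto simp: two_index_def split: prod.splits)
qed

lemma monom_two_index: "monom z (two_index i j (k, m)) = z $ i ^ m * z $ j ^ k"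
proof -
  have "monom z (two_index i j (k, m)) = (\<Prod>x\<in>{i, j}. z $ x ^ two_index i j (k, m) x)"
    unfolding monom_def by (rule prod.mono_neutral_right) (auto simp: two_index_def)
  then show ?thesis using ij by (simp add: two_index_def)
qed

text \<open>Extension by zero from the indices that live on \<open>i\<close> and \<open>j\<close>.
  In a pair (k, m), k is the exponent of z_j and will be the power of \<psi>, while m is the
  exponent of z_i and will be a Taylor index of the k-th power of \<sigma>.\<close>

lemma has_coeffs_two_index:
  assumes "\<And>z. z \<in> polydisk \<Longrightarrow> ((\<lambda>(k, m). A (k, m) * (z $ i ^ m * z $ j ^ k)) has_sum F z) UNIV"
  defines "a \<equiv> \<lambda>\<alpha>. if \<alpha> \<in> range (two_index i j) then A (inv (two_index i j) \<alpha>) else 0"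
  shows "has_coeffs F a" "a (two_index i j v) = A v"
    "((\<lambda>v. (norm (A v))\<^sup>2) has_sum T) UNIV \<Longrightarrow> ((\<lambda>\<alpha>. (norm (a \<alpha>))\<^sup>2) has_sum T) UNIV"
proof -
  have a: "a (two_index i j v) = A v" for v by (simp add: a_def inv_f_f[OF inj_two_index])
  then show "a (two_index i j v) = A v" .
  show "has_coeffs F a" unfolding has_coeffs_def
  proof
    fix z :: "complex^'n" assume "z \<in> polydisk"
    from assms(1)[OF this] have "((\<lambda>\<alpha>. a \<alpha> * monom z \<alpha>) \<circ> two_index i j has_sum F z) UNIV"
      by (rule has_sum_cong[THEN iffD1, rotated]) (auto simp: a monom_two_index)
    then have "((\<lambda>\<alpha>. a \<alpha> * monom z \<alpha>) has_sum F z) (range (two_index i j))"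
      by (simp add: has_sum_reindex[OF inj_two_index])
    then show "((\<lambda>\<alpha>. a \<alpha> * monom z \<alpha>) has_sum F z) UNIV"
      by (rule has_sum_cong_neutral[THEN iffD1, rotated 3]) (auto simp: a_def)
  qed
  assume "((\<lambda>v. (norm (A v))\<^sup>2) has_sum T) UNIV"
  then have "((\<lambda>\<alpha>. (norm (a \<alpha>))\<^sup>2) \<circ> two_index i j has_sum T) UNIV" by (simp add: a o_def)
  then have "((\<lambda>\<alpha>. (norm (a \<alpha>))\<^sup>2) has_sum T) (range (two_index i j))"
    by (simp add: has_sum_reindex[OF inj_two_index])
  then show "((\<lambda>\<alpha>. (norm (a \<alpha>))\<^sup>2) has_sum T) UNIV"
    by (rule has_sum_cong_neutral[THEN iffD1, rotated 3]) (auto simp: a_def)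
qed

end

section \<open>Restriction to a diagonal\<close>

definition diag_map :: "'n set \<Rightarrow> (complex ^ 'n \<Rightarrow> complex) \<Rightarrow> complex ^ 'n \<Rightarrow> complex ^ 'n::finite" where
  "diag_map S \<psi> z = (\<chi> x. if x \<in> S then \<psi> z else 0)"

definition deg_indices :: "'n::finite set \<Rightarrow> nat \<Rightarrow> ('n \<Rightarrow> nat) set" where
  "deg_indices S k = {\<alpha>. sum \<alpha> UNIV = k \<and> (\<forall>x. x \<notin> S \<longrightarrow> \<alpha> x = 0)}"

text \<open>The k-th Taylor coefficient of the restriction of \<open>f\<close> to the diagonal disk
  over \<open>S\<close>.\<close>

definition diag_coeff :: "'n::finite set \<Rightarrow> (complex ^ 'n \<Rightarrow> complex) \<Rightarrow> nat \<Rightarrow> complex" where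
  "diag_coeff S f k = (\<Sum>\<alpha>\<in>deg_indices S k. h2coef f \<alpha>)"

text \<open>The squared norm of the homogeneous part of degree \<open>k\<close>.\<close>

definition deg_energy :: "(complex ^ 'n::finite \<Rightarrow> complex) \<Rightarrow> nat \<Rightarrow> real" where
  "deg_energy f k = (\<Sum>\<alpha> | sum \<alpha> UNIV = k. (norm (h2coef f \<alpha>))\<^sup>2)"

lemma finite_deg_indices: "finite (deg_indices S k)"
  by (rule finite_subset[OF _ finite_multiindices[of k]]) (auto simp: deg_indices_def)

lemma card_deg_indices_le: "card (deg_indices (S :: 'n::finite set) k) \<le> (k + 1) ^ CARD('n)"
  by (rule order_trans[OF card_mono[OF finite_multiindices] card_multiindices]) (auto simp: deg_indices_def)

text \<open>Over a single coordinate no two monomials of equal degree are identified, so restriction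
  to the diagonal costs nothing.\<close>

lemma card_deg_indices_singleton: "card (deg_indices {i} k) \<le> 1"
proof -
  have "deg_indices {i} k \<subseteq> {\<lambda>x. if x = i then k else 0}"
  proof
    fix \<alpha> assume \<alpha>: "\<alpha> \<in> deg_indices {i} k"
    then have "sum \<alpha> UNIV = sum \<alpha> {i}"
      by (intro sum.mono_neutral_right) (auto simp: deg_indices_def)
    with \<alpha> show "\<alpha> \<in> {\<lambda>x. if x = i then k else 0}" by (auto simp: deg_indices_def)
  qed
  then show ?thesis using card_mono[of "{\<lambda>x. if x = i then k else 0}"] by fastforce
qed

text \<open>With 0^0 = 1, a monomial vanishes on the diagonal exactly when it involves a coordinate
  outside \<open>S\<close>, apart from the trivial case \<open>w = 0\<close>.\<close>

lemma monom_diag: "monom (\<chi> x. if x \<in> S then w else 0) \<alpha> =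
  (if \<forall>x. x \<notin> S \<longrightarrow> \<alpha> x = 0 then w ^ sum \<alpha> UNIV else 0)"
proof (cases "\<forall>x. x \<notin> S \<longrightarrow> \<alpha> x = 0")
  case True
  then have "monom (\<chi> x. if x \<in> S then w else 0) \<alpha> = (\<Prod>x\<in>UNIV. w ^ \<alpha> x)"
    unfolding monom_def by (intro prod.cong) auto
  with True show ?thesis by (simp add: power_sum)
next
  case False
  then show ?thesis unfolding monom_def by (auto intro!: prod_zero)
qed

lemma diag_in_polydisk: "norm w < 1 \<Longrightarrow> (\<chi> x. if x \<in> S then w else 0) \<in> polydisk"
  by (auto simp: polydisk_def)

lemma diag_coeff_has_sum:
  assumes f: "f \<in> H2" and w: "norm w < 1"
  shows "((\<lambda>k. diag_coeff S f k * w ^ k) has_sum f (\<chi> x. if x \<in> S then w else 0)) UNIV"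
proof -
  let ?I = "{\<alpha>. \<forall>x. x \<notin> S \<longrightarrow> \<alpha> x = (0::nat)}"
  have eq: "{\<alpha>\<in>?I. sum \<alpha> UNIV = k} = deg_indices S k" for k by (auto simp: deg_indices_def)
  have "((\<lambda>\<alpha>. h2coef f \<alpha> * monom (\<chi> x. if x \<in> S then w else 0) \<alpha>) has_sum f (\<chi> x. if x \<in> S then w else 0)) UNIV"
    using H2_has_coeffs[OF f] diag_in_polydisk[OF w, of S] unfolding has_coeffs_def by blast
  then have "((\<lambda>\<alpha>. h2coef f \<alpha> * w ^ sum \<alpha> UNIV) has_sum f (\<chi> x. if x \<in> S then w else 0)) ?I"
    by (rule has_sum_cong_neutral[THEN iffD1, rotated 3]) (auto simp: monom_diag)
  from has_sum_group_powser[OF _ this] show ?thesis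
    unfolding eq diag_coeff_def by (simp add: finite_deg_indices)
qed

lemma summable_diag_coeff:
  assumes f: "f \<in> H2" and x: "0 \<le> x" "x < 1"
  shows "summable (\<lambda>k. norm (diag_coeff S f k) * x ^ k)"
proof -
  have "(\<lambda>k. diag_coeff S f k * of_real x ^ k) summable_on UNIV"
    using diag_coeff_has_sum[OF f, of "of_real x"] x has_sum_imp_summable by fastforce
  then have "(\<lambda>k. norm (diag_coeff S f k * of_real x ^ k)) summable_on UNIV"
    by (simp add: summable_on_iff_abs_summable_on_complex)
  from summable_on_imp_summable[OF this] x show ?thesis by (simp add: norm_mult norm_power)
qed

lemma deg_energy_nonneg: "deg_energy f k \<ge> 0"
  by (auto simp: deg_energy_def intro: sum_nonneg)

lemma deg_energy_has_sum: "f \<in> H2 \<Longrightarrow> (deg_energy f has_sum (h2norm f)\<^sup>2) UNIV"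
  using has_sum_group_powser[of UNIV "\<lambda>\<alpha>. sum \<alpha> UNIV" "\<lambda>\<alpha>. (norm (h2coef f \<alpha>))\<^sup>2" 1]
  by (simp add: H2_has_sum finite_multiindices deg_energy_def[abs_def])

lemma deg_energy_le: "f \<in> H2 \<Longrightarrow> deg_energy f k \<le> (h2norm f)\<^sup>2"
  using finite_sum_le_has_sum[OF deg_energy_has_sum, of f "{k}"] by (simp add: deg_energy_nonneg)

text \<open>Cauchy-Schwarz over the monomials that become equal on the diagonal; their number is the
  only loss caused by a larger \<open>S\<close>.\<close>

lemma diag_coeff_bound:
  "(norm (diag_coeff S f k))\<^sup>2 \<le> real (card (deg_indices S k)) * deg_energy f k"
proof -
  have "norm (diag_coeff S f k) \<le> (\<Sum>\<alpha>\<in>deg_indices S k. 1 * norm (h2coef f \<alpha>))"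
    unfolding diag_coeff_def by (rule order_trans[OF norm_sum]) simp
  then have "(norm (diag_coeff S f k))\<^sup>2 \<le> (\<Sum>\<alpha>\<in>deg_indices S k. 1 * norm (h2coef f \<alpha>))\<^sup>2"
    by (rule power_mono) simp
  also have "\<dots> \<le> (\<Sum>\<alpha>\<in>deg_indices S k. 1\<^sup>2) * (\<Sum>\<alpha>\<in>deg_indices S k. (norm (h2coef f \<alpha>))\<^sup>2)"
    by (rule Cauchy_Schwarz_ineq_sum)
  also have "\<dots> \<le> real (card (deg_indices S k)) * deg_energy f k"
    unfolding deg_energy_def
    by (simp, intro mult_left_mono sum_mono2) (auto simp: deg_indices_def finite_multiindices)
  finally show ?thesis .
qed

lemma diag_coeff_add:
  assumes "f \<in> H2" "g \<in> H2"
  shows "diag_coeff S (\<lambda>z. f z + g z) k = diag_coeff S f k + diag_coeff S g k"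
  unfolding diag_coeff_def h2coef_eqI[OF has_coeffs_add[OF assms[THEN H2_has_coeffs]]] by (rule sum.distrib)

lemma diag_coeff_mult:
  assumes "f \<in> H2"
  shows "diag_coeff S (\<lambda>z. r * f z) k = r * diag_coeff S f k"
  unfolding diag_coeff_def h2coef_eqI[OF has_coeffs_mult[OF H2_has_coeffs[OF assms]]] by (simp add: sum_distrib_left)

text \<open>Test functions for the lower bounds: an n-dimensional space with orthonormal basis the
  powers of one coordinate.\<close>

lemma coordinate_polynomial_H2:
  fixes x :: "nat \<Rightarrow> complex" and i :: "'n::finite"
  assumes "i \<noteq> j"
  shows "(\<lambda>w. \<Sum>k<n. x k * w $ i ^ k) \<in> H2"
    and "(h2norm (\<lambda>w :: complex ^ 'n. \<Sum>k<n. x k * w $ i ^ k))\<^sup>2 = (\<Sum>k<n. (norm (x k))\<^sup>2)"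
proof -
  let ?A = "\<lambda>(k, m). if k = (0::nat) \<and> m < n then x m else 0"
  have inj: "inj_on (Pair 0) {..<n}" by (auto simp: inj_on_def)
  have 1: "((\<lambda>(k, m). ?A (k, m) * (z $ i ^ m * z $ j ^ k)) has_sum (\<Sum>k<n. x k * z $ i ^ k)) UNIV" for z :: "complex ^ 'n"
    by (rule has_sum_finite_neutralI[of "Pair 0 ` {..<n}"]) (auto simp: sum.reindex[OF inj])
  have 2: "((\<lambda>v. (norm (?A v))\<^sup>2) has_sum (\<Sum>k<n. (norm (x k))\<^sup>2)) UNIV"
    by (rule has_sum_finite_neutralI[of "Pair 0 ` {..<n}"]) (auto simp: sum.reindex[OF inj])
  note c = has_coeffs_two_index[OF assms 1]
  show "(\<lambda>w. \<Sum>k<n. x k * w $ i ^ k) \<in> H2"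
    by (rule h2norm_eqI(1)[OF c(1) c(3)[OF 2]])
  show "(h2norm (\<lambda>w :: complex ^ 'n. \<Sum>k<n. x k * w $ i ^ k))\<^sup>2 = (\<Sum>k<n. (norm (x k))\<^sup>2)"
    unfolding h2norm_eqI(2)[OF c(1) c(3)[OF 2]] by (simp add: sum_nonneg)
qed

text \<open>Gaussian elimination. It provides a nonzero test function on which all the functionals
  of a given finite-rank operator vanish.\<close>

lemma underdetermined_system:
  fixes L :: "nat \<Rightarrow> nat \<Rightarrow> complex"
  assumes "k < n"
  shows "\<exists>x. (\<exists>t<n. x t \<noteq> 0) \<and> (\<forall>r<k. (\<Sum>t<n. L r t * x t) = 0)"
  using assms
proof (induction k arbitrary: n L)
  case 0
  then show ?case by (intro exI[of _ "\<lambda>_. 1"]) auto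
next
  case (Suc k)
  then obtain m where m: "n = Suc m" "k < m" by (cases n) auto
  show ?case
  proof (cases "\<exists>t<n. L k t \<noteq> 0")
    case False
    from Suc.IH[of n L] Suc.prems obtain x where x: "\<exists>t<n. x t \<noteq> 0" "\<forall>r<k. (\<Sum>t<n. L r t * x t) = 0"
      by auto
    with False show ?thesis by (intro exI[of _ x]) (auto simp: less_Suc_eq)
  next
    case True
    then obtain q where q: "q < n" "L k q \<noteq> 0" by blast
    \<comment> \<open>Enumerates the unknowns other than the pivot \<open>q\<close>.\<close>
    define e where "e t = (if t < q then t else Suc t)" for t
    have e: "bij_betw e {..<m} ({..<n} - {q})"
    proof (rule bij_betw_byWitness[where f' = "\<lambda>t. if t < q then t else t - 1"])
    qed (use q m in \<open>auto simp: e_def\<close>)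
    have split: "(\<Sum>t<n. f t) = f q + (\<Sum>t<m. f (e t))" for f :: "nat \<Rightarrow> complex"
      using sum.reindex_bij_betw[OF e, of f] q by (simp add: sum.remove[of "{..<n}" q])
    \<comment> \<open>The equations that remain after the pivot unknown has been eliminated by means
      of equation \<open>k\<close>.\<close>
    from Suc.IH[OF m(2), of "\<lambda>r t. L r (e t) - L r q * L k (e t) / L k q"]
    obtain y where y: "\<exists>t<m. y t \<noteq> 0"
      "\<And>r. r < k \<Longrightarrow> (\<Sum>t<m. (L r (e t) - L r q * L k (e t) / L k q) * y t) = 0" by blast
    define s where "s = (\<Sum>t<m. L k (e t) * y t)"
    define x where "x t = (if t = q then - s / L k q else y (inv_into {..<m} e t))" for t
    have xe: "x (e t) = y t" if "t < m" for t
    proof -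
      have "e t \<noteq> q" by (simp add: e_def)
      with that e show ?thesis by (simp add: x_def bij_betw_def)
    qed
    have sum_x: "(\<Sum>t<n. L r t * x t) = - L r q * s / L k q + (\<Sum>t<m. L r (e t) * y t)" for r
      unfolding split[of "\<lambda>t. L r t * x t"] by (simp add: xe) (simp add: x_def)
    have "(\<Sum>t<n. L r t * x t) = 0" if "r < Suc k" for r
    proof (cases "r = k")
      case True
      then show ?thesis using q by (simp add: sum_x s_def)
    next
      case False
      with that y(2)[of r] have "(\<Sum>t<m. L r (e t) * y t) - L r q / L k q * s = 0"
        by (simp add: s_def sum_subtractf[symmetric] sum_distrib_left algebra_simps)
      then show ?thesis by (simp add: sum_x)
    qed
    moreover obtain t where "t < m" "y t \<noteq> 0" using y(1) by blast
    then have "e t < n" "x (e t) \<noteq> 0" using xe e by (auto simp: bij_betw_def)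
    ultimately show ?thesis by blast
  qed
qed

section \<open>Composition operators with image in a diagonal\<close>

text \<open>Termwise differentiation preserves the radius of convergence and raises the polynomial
  degree by one; a last differentiation supplies the shift from k to k + 1.\<close>

lemma summable_power_times_geometric:
  assumes "0 \<le> x" "x < (1::real)"
  shows "summable (\<lambda>k. real (k + 1) ^ N * x ^ k)"
proof -
  have base: "summable (\<lambda>k. real k ^ N * y ^ k)" if "norm y < 1" for y :: real
    using that
  proof (induction N arbitrary: y)
    case 0
    then show ?case by (simp add: summable_geometric)
  next
    case (Suc N)
    have "summable (\<lambda>k. diffs (\<lambda>k. real k ^ N) k * y ^ k)"
      by (rule termdiff_converges[OF Suc.prems Suc.IH])
    then have "summable (\<lambda>k. y * (diffs (\<lambda>k. real k ^ N) k * y ^ k))" by (rule summable_mult)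
    then have "summable (\<lambda>k. real (Suc k) ^ Suc N * y ^ Suc k)"
      by (simp add: diffs_def algebra_simps)
    then show ?case by (subst (asm) summable_Suc_iff)
  qed
  have "summable (\<lambda>k. diffs (\<lambda>k. real k ^ N) k * x ^ k)"
    using assms by (intro termdiff_converges[of _ 1] base) auto
  then show ?thesis
  proof (rule summable_comparison_test')
    fix k :: nat
    have "real (k + 1) ^ N * x ^ k * 1 \<le> real (k + 1) ^ N * x ^ k * real (k + 1)"
      using assms by (intro mult_left_mono) auto
    then show "norm (real (k + 1) ^ N * x ^ k) \<le> diffs (\<lambda>k. real k ^ N) k * x ^ k"
      using assms by (simp add: diffs_def algebra_simps)
  qed
qed

locale product_symbol =
  fixes i j :: "'n::finite" and \<sigma> :: "complex \<Rightarrow> complex"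
  assumes ij: "i \<noteq> j"
    and hol: "\<sigma> holomorphic_on ball 0 1"
    and norm_le_1: "norm z < 1 \<Longrightarrow> norm (\<sigma> z) \<le> 1"
begin

definition \<psi> :: "complex ^ 'n \<Rightarrow> complex" where
  "\<psi> z = \<sigma> (z $ i) * z $ j"

definition s :: "nat \<Rightarrow> real" where
  "s k = hardy_norm (\<lambda>z. \<sigma> z ^ k)"

definition c :: "nat \<Rightarrow> nat \<Rightarrow> complex" where
  "c k = taylor_coeff (\<lambda>z. \<sigma> z ^ k)"

lemma power_hol: "(\<lambda>z. \<sigma> z ^ k) holomorphic_on ball 0 1"
  by (intro holomorphic_intros hol)

lemma power_le_1: "norm z < 1 \<Longrightarrow> norm (\<sigma> z ^ k) \<le> 1"
  using norm_le_1[of z] by (simp add: norm_power power_le_one)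

lemma s_nonneg: "s k \<ge> 0" and s_le_1: "s k \<le> 1"
  unfolding s_def by (intro hardy_norm_nonneg hardy_norm_le_1 power_hol power_le_1; simp)+

lemma c_has_sum: "((\<lambda>m. (norm (c k m))\<^sup>2) has_sum (s k)\<^sup>2) UNIV"
  unfolding c_def s_def by (intro taylor_coeff_has_sum power_hol power_le_1)

lemma c_le_1: "norm (c k m) \<le> 1"
proof -
  have "(norm (c k m))\<^sup>2 \<le> (s k)\<^sup>2"
    using finite_sum_le_has_sum[OF c_has_sum, of "{m}"] by simp
  then show ?thesis using s_nonneg[of k] s_le_1[of k] by (meson norm_ge_zero order_trans power2_le_imp_le)
qed

lemma norm_psi_less_1:
  assumes "z \<in> polydisk"
  shows "norm (\<psi> z) < 1"
proof -
  have "norm (\<sigma> (z $ i)) * norm (z $ j) \<le> 1 * norm (z $ j)"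
    using assms by (intro mult_right_mono norm_le_1) (auto simp: polydisk_def)
  also have "\<dots> < 1" using assms by (simp add: polydisk_def)
  finally show ?thesis by (simp add: \<psi>_def norm_mult)
qed

text \<open>The k-th power of \<psi> only contains monomials with exponent k at z_j, so different
  powers share no monomial and Pythagoras gives the norm. The growth condition on \<open>b\<close>
  provides absolute convergence of the double series.\<close>

lemma psi_series_H2:
  assumes b: "\<And>x. 0 \<le> x \<Longrightarrow> x < 1 \<Longrightarrow> summable (\<lambda>k. norm (b k) * x ^ k)"
    and T: "((\<lambda>k. (norm (b k))\<^sup>2 * (s k)\<^sup>2) has_sum T) UNIV"
    and G: "\<And>z. z \<in> polydisk \<Longrightarrow> (\<lambda>k. b k * \<psi> z ^ k) sums G z"
  shows "G \<in> H2" "h2norm G = sqrt T"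
proof -
  let ?A = "\<lambda>(k, m). b k * c k m"
  have 1: "((\<lambda>(k, m). ?A (k, m) * (z $ i ^ m * z $ j ^ k)) has_sum G z) UNIV" if z: "z \<in> polydisk" for z
  proof -
    have zi: "norm (z $ i) < 1" and zj: "norm (z $ j) < 1" using z by (auto simp: polydisk_def)
    have inner: "((\<lambda>m. b k * c k m * (z $ i ^ m * z $ j ^ k)) has_sum b k * \<psi> z ^ k) UNIV" for k
    proof -
      have "summable (\<lambda>m. norm (c k m * z $ i ^ m))"
      proof (rule summable_comparison_test')
        show "summable (\<lambda>m. norm (z $ i) ^ m)" using zi by (simp add: summable_geometric)
        show "norm (norm (c k m * z $ i ^ m)) \<le> norm (z $ i) ^ m" for m
          using mult_right_mono[OF c_le_1, of "norm (z $ i) ^ m" k m] by (simp add: norm_mult norm_power)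
      qed
      moreover have "(\<lambda>m. c k m * z $ i ^ m) sums (\<sigma> (z $ i) ^ k)"
        unfolding c_def by (rule taylor_coeff_sums[OF power_hol zi])
      ultimately have "((\<lambda>m. c k m * z $ i ^ m) has_sum \<sigma> (z $ i) ^ k) UNIV"
        by (rule norm_summable_imp_has_sum)
      from has_sum_cmult_right[OF this, of "b k * z $ j ^ k"] show ?thesis
        by (simp add: \<psi>_def power_mult_distrib mult_ac)
    qed
    have outer: "((\<lambda>k. b k * \<psi> z ^ k) has_sum G z) UNIV"
      using b[of "norm (\<psi> z)"] norm_psi_less_1[OF z] G[OF z]
      by (intro norm_summable_imp_has_sum) (auto simp: norm_mult norm_power)
    \<comment> \<open>Dominating family: the Taylor coefficients have modulus at most 1, which
      decouples the two indices.\<close>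
    have "(\<lambda>(k, m). (norm (b k) * norm (z $ j) ^ k) * norm (z $ i) ^ m) summable_on Sigma UNIV (\<lambda>_. UNIV)"
    proof (rule summable_on_SigmaI)
      show "((\<lambda>m. case (k, m) of (k, m) \<Rightarrow> norm (b k) * norm (z $ j) ^ k * norm (z $ i) ^ m)
        has_sum norm (b k) * norm (z $ j) ^ k * (1 / (1 - norm (z $ i)))) UNIV" for k
        unfolding prod.case using geometric_sums[of "norm (z $ i)"] zi
        by (intro has_sum_cmult_right sums_nonneg_imp_has_sum) auto
      show "(\<lambda>k. norm (b k) * norm (z $ j) ^ k * (1 / (1 - norm (z $ i)))) summable_on UNIV"
        using b[of "norm (z $ j)"] zj by (intro summable_on_cmult_left) (auto simp: summable_on_UNIV_nonneg_real_iff)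
    qed auto
    then have "(\<lambda>v. norm ((\<lambda>(k, m). b k * c k m * (z $ i ^ m * z $ j ^ k)) v)) summable_on Sigma UNIV (\<lambda>_. UNIV)"
    proof (rule summable_on_comparison_test)
      fix v :: "nat \<times> nat"
      obtain k m where v: "v = (k, m)" by (cases v)
      have "norm (c k m) * (norm (b k) * norm (z $ j) ^ k * norm (z $ i) ^ m) \<le> 1 * (norm (b k) * norm (z $ j) ^ k * norm (z $ i) ^ m)"
        by (intro mult_right_mono c_le_1) auto
      then show "norm ((\<lambda>(k, m). b k * c k m * (z $ i ^ m * z $ j ^ k)) v) \<le>
        (\<lambda>(k, m). (norm (b k) * norm (z $ j) ^ k) * norm (z $ i) ^ m) v"
        by (simp add: v norm_mult norm_power mult_ac)
    qed auto
    then have "(\<lambda>(k, m). b k * c k m * (z $ i ^ m * z $ j ^ k)) summable_on Sigma UNIV (\<lambda>_. UNIV)"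
      by (rule abs_summable_summable)
    then have "((\<lambda>(k, m). b k * c k m * (z $ i ^ m * z $ j ^ k)) has_sum G z) (Sigma UNIV (\<lambda>_. UNIV))"
      by (intro has_sum_SigmaI[where g = "\<lambda>k. b k * \<psi> z ^ k"]) (use inner outer in auto)
    then show ?thesis by simp
  qed
  have inner: "((\<lambda>m. (norm (b k * c k m))\<^sup>2) has_sum (norm (b k))\<^sup>2 * (s k)\<^sup>2) UNIV" for k
    unfolding norm_mult power_mult_distrib by (intro has_sum_cmult_right c_has_sum)
  have "(\<lambda>v. (norm (?A v))\<^sup>2) summable_on Sigma UNIV (\<lambda>_. UNIV)"
    by (rule summable_on_SigmaI[where g = "\<lambda>k. (norm (b k))\<^sup>2 * (s k)\<^sup>2"])
      (use inner T in \<open>auto simp: has_sum_imp_summable\<close>)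
  then have "((\<lambda>v. (norm (?A v))\<^sup>2) has_sum T) (Sigma UNIV (\<lambda>_. UNIV))"
    by (intro has_sum_SigmaI[where g = "\<lambda>k. (norm (b k))\<^sup>2 * (s k)\<^sup>2"]) (use inner T in auto)
  then have 2: "((\<lambda>v. (norm (?A v))\<^sup>2) has_sum T) UNIV" by simp
  note cf = has_coeffs_two_index[OF ij 1]
  show "G \<in> H2" by (rule h2norm_eqI(1)[OF cf(1) cf(3)[OF _ 2]])
  show "h2norm G = sqrt T" by (rule h2norm_eqI(2)[OF cf(1) cf(3)[OF _ 2]])
qed

lemma psi_polynomial_H2:
  shows "(\<lambda>z. \<Sum>k<n. x k * \<psi> z ^ k) \<in> H2"
    and "(h2norm (\<lambda>z. \<Sum>k<n. x k * \<psi> z ^ k))\<^sup>2 = (\<Sum>k<n. (norm (x k))\<^sup>2 * (s k)\<^sup>2)"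
proof -
  let ?b = "\<lambda>k. if k < n then x k else 0"
  have 1: "summable (\<lambda>k. norm (?b k) * y ^ k)" for y :: real
    by (rule summable_finite[of "{..<n}"]) auto
  have 2: "((\<lambda>k. (norm (?b k))\<^sup>2 * (s k)\<^sup>2) has_sum (\<Sum>k<n. (norm (x k))\<^sup>2 * (s k)\<^sup>2)) UNIV"
    by (rule has_sum_finite_neutralI[of "{..<n}"]) auto
  have 3: "(\<lambda>k. ?b k * \<psi> z ^ k) sums (\<Sum>k<n. x k * \<psi> z ^ k)" for z
    using sums_finite[of "{..<n}" "\<lambda>k. ?b k * \<psi> z ^ k"] by simp
  note * = psi_series_H2[OF 1 2 3]
  show "(\<lambda>z. \<Sum>k<n. x k * \<psi> z ^ k) \<in> H2" by (rule *(1))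
  show "(h2norm (\<lambda>z. \<Sum>k<n. x k * \<psi> z ^ k))\<^sup>2 = (\<Sum>k<n. (norm (x k))\<^sup>2 * (s k)\<^sup>2)"
    unfolding *(2) by (simp add: sum_nonneg)
qed

lemma psi_power_H2: "(\<lambda>z. \<psi> z ^ k) \<in> H2"
proof -
  have "(\<lambda>z. \<Sum>m<Suc k. (if m = k then 1 else 0) * \<psi> z ^ m) \<in> H2" by (rule psi_polynomial_H2)
  then show ?thesis by simp
qed

lemma comp_op_sums:
  assumes "f \<in> H2" "z \<in> polydisk"
  shows "(\<lambda>k. diag_coeff S f k * \<psi> z ^ k) sums comp_op (diag_map S \<psi>) f z"
  using has_sum_imp_sums[OF diag_coeff_has_sum[OF assms(1) norm_psi_less_1[OF assms(2)]]]
  by (simp add: comp_op_def diag_map_def)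

context
  fixes S :: "'n set" and u :: "nat \<Rightarrow> real"
  assumes u: "antimono u" "\<And>k. u k \<ge> 0"
    and us: "\<And>k. real (card (deg_indices S k)) * (s k)\<^sup>2 \<le> (u k)\<^sup>2"
begin

text \<open>Each degree costs at most \<open>u k\<close> by Cauchy-Schwarz, and monotonicity of
  \<open>u\<close> turns this into \<open>u n\<close> for the whole tail. The case
  \<open>n = 0\<close> is boundedness, the general case bounds the approximation numbers.\<close>

lemma tail_H2:
  fixes n :: nat and f
  defines "R \<equiv> \<lambda>z. comp_op (diag_map S \<psi>) f z - (\<Sum>k<n. diag_coeff S f k * \<psi> z ^ k)"
  assumes f: "f \<in> H2"
  shows "R \<in> H2" "h2norm R \<le> u n * h2norm f"
proof -
  define b where "b k = (if k < n then 0 else diag_coeff S f k)" for k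
  have 1: "summable (\<lambda>k. norm (b k) * x ^ k)" if "0 \<le> x" "x < 1" for x
    by (rule summable_comparison_test'[OF summable_diag_coeff[OF f that, of S]]) (use that in \<open>auto simp: b_def\<close>)
  have le: "(norm (b k))\<^sup>2 * (s k)\<^sup>2 \<le> (u n)\<^sup>2 * deg_energy f k" for k
  proof (cases "k < n")
    case False
    have "(norm (b k))\<^sup>2 * (s k)\<^sup>2 \<le> real (card (deg_indices S k)) * deg_energy f k * (s k)\<^sup>2"
      using False by (intro mult_right_mono) (auto simp: b_def diag_coeff_bound)
    also have "\<dots> = real (card (deg_indices S k)) * (s k)\<^sup>2 * deg_energy f k" by simp
    also have "\<dots> \<le> (u k)\<^sup>2 * deg_energy f k"
      by (intro mult_right_mono us deg_energy_nonneg)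
    also have "\<dots> \<le> (u n)\<^sup>2 * deg_energy f k"
      using False u by (intro mult_right_mono power_mono deg_energy_nonneg) (auto simp: antimono_def)
    finally show ?thesis .
  qed (simp add: b_def deg_energy_nonneg)
  have E: "((\<lambda>k. (u n)\<^sup>2 * deg_energy f k) has_sum (u n)\<^sup>2 * (h2norm f)\<^sup>2) UNIV"
    by (intro has_sum_cmult_right deg_energy_has_sum f)
  have "(\<lambda>k. (norm (b k))\<^sup>2 * (s k)\<^sup>2) summable_on UNIV"
    by (rule summable_on_comparison_test[OF has_sum_imp_summable[OF E]]) (use le in auto)
  then obtain T where T: "((\<lambda>k. (norm (b k))\<^sup>2 * (s k)\<^sup>2) has_sum T) UNIV"
    by (auto simp: summable_on_def)
  have 3: "(\<lambda>k. b k * \<psi> z ^ k) sums R z" if z: "z \<in> polydisk" for z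
  proof -
    have "(\<lambda>k. if k < n then diag_coeff S f k * \<psi> z ^ k else 0) sums (\<Sum>k<n. diag_coeff S f k * \<psi> z ^ k)"
      using sums_If_finite_set[of "{..<n}" "\<lambda>k. diag_coeff S f k * \<psi> z ^ k"] by simp
    from sums_diff[OF comp_op_sums[OF f z, of S] this] show ?thesis
      unfolding R_def by (rule sums_cong[THEN iffD1, rotated]) (simp add: b_def)
  qed
  show "R \<in> H2" by (rule psi_series_H2(1)[OF 1 T 3])
  have norm_R: "h2norm R = sqrt T" by (rule psi_series_H2(2)[OF 1 T 3])
  have "T \<le> (u n)\<^sup>2 * (h2norm f)\<^sup>2" by (rule has_sum_mono[OF T E]) (use le in auto)
  then have "sqrt T \<le> sqrt ((u n * h2norm f)\<^sup>2)" by (simp add: power_mult_distrib)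
  then show "h2norm R \<le> u n * h2norm f"
    unfolding norm_R using u h2norm_nonneg[OF f] by simp
qed

lemma comp_bounded_diag: "comp_bounded (diag_map S \<psi>)"
  using tail_H2[where n = 0] unfolding comp_bounded_def by auto

text \<open>Truncation after the first \<open>n\<close> powers of \<psi> has rank at most
  \<open>n\<close>, hence is admissible for the index \<open>Suc n\<close>.\<close>

lemma approx_num_le: "approx_num (comp_op (diag_map S \<psi>)) (Suc n) \<le> u n"
  unfolding approx_num_def
proof (rule cInf_lower)
  show "u n \<in> {c. c \<ge> 0 \<and>
     (\<exists>k (l :: nat \<Rightarrow> (complex ^ 'n \<Rightarrow> complex) \<Rightarrow> complex) g. k < Suc n \<and>
        (\<forall>i<k. g i \<in> H2 \<and>
           (\<forall>f\<in>H2. \<forall>h\<in>H2. l i (\<lambda>z. f z + h z) = l i f + l i h) \<and>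
           (\<forall>f\<in>H2. \<forall>a. l i (\<lambda>z. a * f z) = a * l i f)) \<and>
        (\<forall>f\<in>H2. h2norm (\<lambda>z. comp_op (diag_map S \<psi>) f z - (\<Sum>i<k. l i f * g i z)) \<le> c * h2norm f))}"
    using u(2) tail_H2(2)[where n = n]
    by (intro CollectI conjI exI[of _ n] exI[of _ "\<lambda>k f. diag_coeff S f k"] exI[of _ "\<lambda>k z. \<psi> z ^ k"])
      (auto simp: psi_power_H2 diag_coeff_add diag_coeff_mult)
qed (auto intro!: bdd_belowI[of _ 0])

end

text \<open>A diagonal subsequence makes every diagonal coefficient converge; the summable weights
  then dominate the squared distances to the limit series.\<close>

lemma comp_compact_diag:
  assumes bdd: "comp_bounded (diag_map S \<psi>)"
    and sum: "summable (\<lambda>k. real (card (deg_indices S k)) * (s k)\<^sup>2)"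
  shows "comp_compact (diag_map S \<psi>)"
  unfolding comp_compact_def
proof (intro conjI bdd allI impI)
  fix fs :: "nat \<Rightarrow> complex ^ 'n \<Rightarrow> complex"
  assume "\<forall>j. fs j \<in> H2 \<and> h2norm (fs j) \<le> 1"
  then have fs: "fs t \<in> H2" "h2norm (fs t) \<le> 1" for t by auto
  define D where "D k = real (card (deg_indices S k))" for k
  define b where "b t k = diag_coeff S (fs t) k" for t k
  have D: "D k \<ge> 0" for k by (simp add: D_def)
  have b2: "(norm (b t k))\<^sup>2 \<le> D k" for t k
  proof -
    have "(h2norm (fs t))\<^sup>2 \<le> 1"
      using fs[of t] h2norm_nonneg[of "fs t"] by (simp add: abs_square_le_1)
    then have "deg_energy (fs t) k \<le> 1" using deg_energy_le[OF fs(1), of t k] by linarith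
    then have "D k * deg_energy (fs t) k \<le> D k * 1" by (intro mult_left_mono D)
    then show ?thesis using diag_coeff_bound[of S "fs t" k] by (simp add: b_def D_def)
  qed
  then have b1: "norm (b t k) \<le> sqrt (D k)" for t k by (simp add: real_le_rsqrt)
  have sD: "sqrt (D k) \<le> 1 + D k" for k
    using D[of k] by (intro real_le_lsqrt) (auto simp: power2_eq_square algebra_simps)
  \<comment> \<open>The extraction needs a bound uniform in \<open>k\<close>. Dividing by
    \<open>1 + D k\<close> achieves this and stays safe where \<open>D k\<close> is 0.\<close>
  obtain r where r: "strict_mono (r :: nat \<Rightarrow> nat)"
    "\<And>k. \<exists>l. (\<lambda>t. b (r t) k / of_real (1 + D k)) \<longlonglongrightarrow> l"
  proof (rule function_convergent_subsequence[of UNIV "\<lambda>t k. b t k / of_real (1 + D k)" 1])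
    fix t k
    have "norm (b t k) \<le> 1 + D k" using b1[of t k] sD[of k] by linarith
    moreover have "norm (of_real (1 + D k) :: complex) = 1 + D k"
      unfolding norm_of_real using D[of k] by simp
    ultimately show "norm (b t k / of_real (1 + D k)) \<le> 1"
      using D[of k] by (simp add: norm_divide del: of_real_add)
  qed auto
  define l where "l k = lim (\<lambda>t. b (r t) k / of_real (1 + D k))" for k
  have l: "(\<lambda>t. b (r t) k / of_real (1 + D k)) \<longlonglongrightarrow> l k" for k
    unfolding l_def using r(2)[of k] unfolding convergent_def[symmetric] convergent_LIMSEQ_iff .
  define \<beta> where "\<beta> k = of_real (1 + D k) * l k" for k
  have lim: "(\<lambda>t. b (r t) k) \<longlonglongrightarrow> \<beta> k" for k
  proof -
    have "of_real (1 + D k) \<noteq> (0 :: complex)" using D[of k] unfolding of_real_eq_0_iff by linarith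
    then show ?thesis
      using tendsto_mult_left[OF l[of k], of "of_real (1 + D k)"] by (simp add: \<beta>_def)
  qed
  have \<beta>1: "norm (\<beta> k) \<le> sqrt (D k)" for k
    using tendsto_norm[OF lim[of k]] b1 by (intro LIMSEQ_le_const2) auto
  \<comment> \<open>Polynomial growth of the limit coefficients suffices for the limit series to
    converge on the whole disk.\<close>
  have \<beta>sum: "summable (\<lambda>k. norm (\<beta> k) * x ^ k)" if x: "0 \<le> x" "x < 1" for x
  proof (rule summable_comparison_test')
    show "summable (\<lambda>k. x ^ k + real (k + 1) ^ CARD('n) * x ^ k)"
      using x by (intro summable_add summable_power_times_geometric summable_geometric) auto
    fix k
    have "D k \<le> real (k + 1) ^ CARD('n)"
      unfolding D_def using card_deg_indices_le[of S k] by (metis of_nat_le_iff of_nat_power)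
    then have "norm (\<beta> k) \<le> 1 + real (k + 1) ^ CARD('n)" using \<beta>1[of k] sD[of k] by linarith
    then have "norm (\<beta> k) * x ^ k \<le> (1 + real (k + 1) ^ CARD('n)) * x ^ k"
      using x by (intro mult_right_mono) auto
    then show "norm (norm (\<beta> k) * x ^ k) \<le> x ^ k + real (k + 1) ^ CARD('n) * x ^ k"
      using x by (simp add: algebra_simps)
  qed
  have le: "(norm w)\<^sup>2 * (s k)\<^sup>2 \<le> 4 * (D k * (s k)\<^sup>2)" if "norm w \<le> 2 * sqrt (D k)" for w :: complex and k
  proof -
    have "(norm w)\<^sup>2 \<le> (2 * sqrt (D k))\<^sup>2" using that by (rule power_mono) simp
    also have "\<dots> = 4 * D k" using D[of k] by (simp add: power_mult_distrib)
    finally show ?thesis using mult_right_mono[of "(norm w)\<^sup>2" "4 * D k" "(s k)\<^sup>2"] by simp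
  qed
  have sumM: "summable (\<lambda>k. 4 * (D k * (s k)\<^sup>2))" using sum by (intro summable_mult) (simp add: D_def)
  define g where "g z = (\<Sum>k. \<beta> k * \<psi> z ^ k)" for z
  have gs: "(\<lambda>k. \<beta> k * \<psi> z ^ k) sums g z" if "z \<in> polydisk" for z
    unfolding g_def
  proof (rule summable_sums[OF summable_norm_cancel])
    show "summable (\<lambda>k. norm (\<beta> k * \<psi> z ^ k))"
      using \<beta>sum[of "norm (\<psi> z)"] norm_psi_less_1[OF that] by (simp add: norm_mult norm_power)
  qed
  have has_sum_le: "((\<lambda>k. (norm (w k))\<^sup>2 * (s k)\<^sup>2) has_sum (\<Sum>k. (norm (w k))\<^sup>2 * (s k)\<^sup>2)) UNIV"
    if "\<And>k. norm (w k) \<le> 2 * sqrt (D k)" for w :: "nat \<Rightarrow> complex"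
  proof (rule sums_nonneg_imp_has_sum[OF summable_sums])
    show "summable (\<lambda>k. (norm (w k))\<^sup>2 * (s k)\<^sup>2)"
      by (rule summable_comparison_test'[OF sumM]) (simp add: le[OF that])
  qed auto
  have "norm (\<beta> k) \<le> 2 * sqrt (D k)" for k using \<beta>1[of k] norm_ge_zero[of "\<beta> k"] by linarith
  from psi_series_H2(1)[OF \<beta>sum has_sum_le[OF this] gs] have g: "g \<in> H2" by simp
  have diff: "norm (b t k - \<beta> k) \<le> 2 * sqrt (D k)" for t k
    using norm_triangle_ineq4[of "b t k" "\<beta> k"] b1[of t k] \<beta>1[of k] by linarith
  have nrm: "h2norm (\<lambda>z. comp_op (diag_map S \<psi>) (fs t) z - g z) = sqrt (\<Sum>k. (norm (b t k - \<beta> k))\<^sup>2 * (s k)\<^sup>2)" for t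
  proof (rule psi_series_H2(2)[OF _ has_sum_le[OF diff]])
    fix x :: real assume x: "0 \<le> x" "x < 1"
    show "summable (\<lambda>k. norm (b t k - \<beta> k) * x ^ k)"
    proof (rule summable_comparison_test')
      show "summable (\<lambda>k. norm (b t k) * x ^ k + norm (\<beta> k) * x ^ k)"
        unfolding b_def by (intro summable_add summable_diag_coeff \<beta>sum fs x)
      show "norm (norm (b t k - \<beta> k) * x ^ k) \<le> norm (b t k) * x ^ k + norm (\<beta> k) * x ^ k" for k
        using mult_right_mono[OF norm_triangle_ineq4[of "b t k" "\<beta> k"], of "x ^ k"] x
        by (simp add: algebra_simps)
    qed
  next
    fix z :: "complex ^ 'n" assume z: "z \<in> polydisk"
    show "(\<lambda>k. (b t k - \<beta> k) * \<psi> z ^ k) sums (comp_op (diag_map S \<psi>) (fs t) z - g z)"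
      using sums_diff[OF comp_op_sums[OF fs(1) z] gs[OF z]] by (simp add: b_def left_diff_distrib)
  qed
  have "(\<lambda>t. \<Sum>k. (norm (b (r t) k - \<beta> k))\<^sup>2 * (s k)\<^sup>2) \<longlonglongrightarrow> (\<Sum>k. 0)"
  \<comment> \<open>Dominated convergence for series; the factor 4 in the dominating term is the
    square of the 2 in \<open>diff\<close>.\<close>
  proof (rule tannerys_theorem[THEN conjunct2, THEN conjunct2])
    show "(\<lambda>t. (norm (b (r t) k - \<beta> k))\<^sup>2 * (s k)\<^sup>2) \<longlonglongrightarrow> 0" for k
    proof -
      have "(\<lambda>t. (norm (b (r t) k - \<beta> k))\<^sup>2 * (s k)\<^sup>2) \<longlonglongrightarrow> (norm (\<beta> k - \<beta> k))\<^sup>2 * (s k)\<^sup>2"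
        by (intro tendsto_intros lim)
      then show ?thesis by simp
    qed
    show "\<forall>\<^sub>F (k, t) in sequentially \<times>\<^sub>F sequentially.
        norm ((norm (b (r t) k - \<beta> k))\<^sup>2 * (s k)\<^sup>2) \<le> 4 * (D k * (s k)\<^sup>2)"
      by (intro always_eventually) (simp add: le[OF diff] split: prod.split)
  qed (rule sumM, simp)
  then have "(\<lambda>t. sqrt (\<Sum>k. (norm (b (r t) k - \<beta> k))\<^sup>2 * (s k)\<^sup>2)) \<longlonglongrightarrow> sqrt 0"
    by (intro tendsto_real_sqrt) simp
  then show "\<exists>r g. strict_mono r \<and> g \<in> H2 \<and>
      (\<lambda>t. h2norm (\<lambda>z. comp_op (diag_map S \<psi>) (fs (r t)) z - g z)) \<longlonglongrightarrow> 0"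
    unfolding nrm[symmetric] real_sqrt_zero by (intro exI[of _ r] exI[of _ g] conjI r(1) g)
qed

lemma comp_op_coordinate_polynomial:
  assumes "i \<in> S"
  shows "comp_op (diag_map S \<psi>) (\<lambda>w. \<Sum>k<n. x k * w $ i ^ k) = (\<lambda>z. \<Sum>k<n. x k * \<psi> z ^ k)"
  using assms by (simp add: comp_op_def diag_map_def)

text \<open>An operator of rank at most \<open>n\<close> kills the functionals' common kernel, which
  meets the (n + 1)-dimensional space of polynomials of degree at most \<open>n\<close> in w_i.
  There the composition operator alone remains; it is diagonal with entries \<open>s k\<close>, each
  at least \<open>v n\<close> for k \<le> n.\<close>

lemma approx_num_ge:
  assumes S: "i \<in> S" and bdd: "comp_bounded (diag_map S \<psi>)"
    and v: "antimono v" "\<And>k. v k \<ge> 0" "\<And>k. v k \<le> s k"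
  shows "v n \<le> approx_num (comp_op (diag_map S \<psi>)) (Suc n)"
  unfolding approx_num_def
proof (rule cInf_greatest)
  obtain C where C: "\<And>f. f \<in> H2 \<Longrightarrow> h2norm (comp_op (diag_map S \<psi>) f) \<le> C * h2norm f"
    using bdd by (auto simp: comp_bounded_def)
  \<comment> \<open>Boundedness makes the set under the infimum nonempty, by approximation with rank
    0; \<open>max\<close> is taken since the set only contains nonnegative constants.\<close>
  have "h2norm (comp_op (diag_map S \<psi>) f) \<le> max C 0 * h2norm f" if "f \<in> H2" for f
    using C[OF that] mult_right_mono[of C "max C 0" "h2norm f"] h2norm_nonneg[OF that] by linarith
  then have "max C 0 \<in> {c. c \<ge> 0 \<and>
     (\<exists>k (l :: nat \<Rightarrow> (complex ^ 'n \<Rightarrow> complex) \<Rightarrow> complex) g. k < Suc n \<and>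
        (\<forall>i<k. g i \<in> H2 \<and>
           (\<forall>f\<in>H2. \<forall>h\<in>H2. l i (\<lambda>z. f z + h z) = l i f + l i h) \<and>
           (\<forall>f\<in>H2. \<forall>a. l i (\<lambda>z. a * f z) = a * l i f)) \<and>
        (\<forall>f\<in>H2. h2norm (\<lambda>z. comp_op (diag_map S \<psi>) f z - (\<Sum>i<k. l i f * g i z)) \<le> c * h2norm f))}"
    by (intro CollectI conjI exI[of _ 0]) auto
  then show "{c. c \<ge> 0 \<and>
     (\<exists>k (l :: nat \<Rightarrow> (complex ^ 'n \<Rightarrow> complex) \<Rightarrow> complex) g. k < Suc n \<and>
        (\<forall>i<k. g i \<in> H2 \<and>
           (\<forall>f\<in>H2. \<forall>h\<in>H2. l i (\<lambda>z. f z + h z) = l i f + l i h) \<and>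
           (\<forall>f\<in>H2. \<forall>a. l i (\<lambda>z. a * f z) = a * l i f)) \<and>
        (\<forall>f\<in>H2. h2norm (\<lambda>z. comp_op (diag_map S \<psi>) f z - (\<Sum>i<k. l i f * g i z)) \<le> c * h2norm f))} \<noteq> {}"
    by blast
next
  fix C
  assume "C \<in> {c. c \<ge> 0 \<and>
     (\<exists>k (l :: nat \<Rightarrow> (complex ^ 'n \<Rightarrow> complex) \<Rightarrow> complex) g. k < Suc n \<and>
        (\<forall>i<k. g i \<in> H2 \<and>
           (\<forall>f\<in>H2. \<forall>h\<in>H2. l i (\<lambda>z. f z + h z) = l i f + l i h) \<and>
           (\<forall>f\<in>H2. \<forall>a. l i (\<lambda>z. a * f z) = a * l i f)) \<and>
        (\<forall>f\<in>H2. h2norm (\<lambda>z. comp_op (diag_map S \<psi>) f z - (\<Sum>i<k. l i f * g i z)) \<le> c * h2norm f))}"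
  then obtain m and l :: "nat \<Rightarrow> (complex ^ 'n \<Rightarrow> complex) \<Rightarrow> complex" and g
    where m: "m < Suc n"
      and add: "\<And>t f h. t < m \<Longrightarrow> f \<in> H2 \<Longrightarrow> h \<in> H2 \<Longrightarrow> l t (\<lambda>z. f z + h z) = l t f + l t h"
      and mult: "\<And>t f a. t < m \<Longrightarrow> f \<in> H2 \<Longrightarrow> l t (\<lambda>z. a * f z) = a * l t f"
      and C: "\<And>f. f \<in> H2 \<Longrightarrow> h2norm (\<lambda>z. comp_op (diag_map S \<psi>) f z - (\<Sum>t<m. l t f * g t z)) \<le> C * h2norm f"
    by blast
  have poly: "(\<lambda>w :: complex ^ 'n. \<Sum>k<q. y k * w $ i ^ k) \<in> H2" for y q
    by (rule coordinate_polynomial_H2[OF ij])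
  have power: "(\<lambda>w :: complex ^ 'n. w $ i ^ k) \<in> H2" for k
    using poly[of "\<lambda>q. if q = k then 1 else 0" "Suc k"] by simp
  have cpower: "(\<lambda>w :: complex ^ 'n. a * w $ i ^ k) \<in> H2" for a k
    using poly[of "\<lambda>q. if q = k then a else 0" "Suc k"] by simp
  have lin: "l t (\<lambda>w. \<Sum>k<q. y k * w $ i ^ k) = (\<Sum>k<q. l t (\<lambda>w. w $ i ^ k) * y k)" if t: "t < m" for t y q
  proof (induction q)
    case 0
    then show ?case using mult[OF t poly[of y 0], of 0] by simp
  next
    case (Suc q)
    then show ?case
      using add[OF t poly[of y q] cpower[of "y q" q]] mult[OF t power[of q], of "y q"] by (simp add: mult.commute)
  qed
  \<comment> \<open>At most \<open>n\<close> equations for \<open>n + 1\<close> unknown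
    coefficients.\<close>
  obtain x where x: "\<exists>t<Suc n. x t \<noteq> 0"
    "\<And>t. t < m \<Longrightarrow> (\<Sum>k<Suc n. l t (\<lambda>w. w $ i ^ k) * x k) = 0"
    using underdetermined_system[OF m, of "\<lambda>t k. l t (\<lambda>w. w $ i ^ k)"] by blast
  let ?f = "\<lambda>w :: complex ^ 'n. \<Sum>k<Suc n. x k * w $ i ^ k"
  have l0: "l t ?f = 0" if "t < m" for t unfolding lin[OF that] by (rule x(2)[OF that])
  have "(\<lambda>z. comp_op (diag_map S \<psi>) ?f z - (\<Sum>t<m. l t ?f * g t z)) = (\<lambda>z. \<Sum>k<Suc n. x k * \<psi> z ^ k)"
    unfolding comp_op_coordinate_polynomial[OF S] using l0 by (intro ext) (simp del: sum.lessThan_Suc)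
  with C[OF poly[of x "Suc n"]] have le: "h2norm (\<lambda>z. \<Sum>k<Suc n. x k * \<psi> z ^ k) \<le> C * h2norm ?f" by metis
  have f2: "(h2norm ?f)\<^sup>2 = (\<Sum>k<Suc n. (norm (x k))\<^sup>2)" by (rule coordinate_polynomial_H2[OF ij])
  have "(v n * h2norm ?f)\<^sup>2 = (\<Sum>k<Suc n. (norm (x k))\<^sup>2 * (v n)\<^sup>2)"
    unfolding power_mult_distrib f2 by (subst mult.commute) (rule sum_distrib_right)
  also have "\<dots> \<le> (\<Sum>k<Suc n. (norm (x k))\<^sup>2 * (s k)\<^sup>2)"
  proof (intro sum_mono mult_left_mono power_mono v)
    fix k assume "k \<in> {..<Suc n}"
    then have "v n \<le> v k" using v(1) by (auto simp: antimono_def)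
    with v(3) show "v n \<le> s k" by (meson order_trans)
  qed auto
  also have "\<dots> = (h2norm (\<lambda>z. \<Sum>k<Suc n. x k * \<psi> z ^ k))\<^sup>2" by (rule psi_polynomial_H2(2)[symmetric])
  finally have "v n * h2norm ?f \<le> h2norm (\<lambda>z. \<Sum>k<Suc n. x k * \<psi> z ^ k)"
    using h2norm_nonneg[OF psi_polynomial_H2(1)] by (rule power2_le_imp_le)
  with le have "v n * h2norm ?f \<le> C * h2norm ?f" by linarith
  moreover have "h2norm ?f > 0"
  proof -
    obtain t where t: "t < Suc n" "x t \<noteq> 0" using x(1) by blast
    then have "(\<Sum>k<Suc n. (norm (x k))\<^sup>2) > 0" by (intro sum_pos2[of _ t]) auto
    then have "(h2norm ?f)\<^sup>2 > 0" unfolding f2 .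
    then show ?thesis using h2norm_nonneg[OF poly[of x "Suc n"]] by (metis less_eq_real_def zero_eq_power2 less_irrefl)
  qed
  ultimately show "v n \<le> C" by simp
qed

end

context product_symbol
begin

lemma analytic_self_map_diag: "analytic_self_map (diag_map S \<psi>)"
  unfolding analytic_self_map_def
proof (intro conjI ballI allI)
  fix z :: "complex ^ 'n" assume "z \<in> polydisk"
  then show "diag_map S \<psi> z \<in> polydisk"
    unfolding diag_map_def by (intro diag_in_polydisk norm_psi_less_1)
next
  fix x :: 'n
  show "holo_polydisk (\<lambda>z. diag_map S \<psi> z $ x)"
    unfolding holo_polydisk_def
  proof
    fix z :: "complex ^ 'n" assume "z \<in> polydisk"
    then have "z $ i \<in> ball 0 1" by (simp add: polydisk_def)
    then obtain d where "(\<sigma> has_field_derivative d) (at (z $ i))"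
      using hol open_ball by (meson field_differentiable_def holomorphic_on_imp_differentiable_at)
    then have d: "(\<sigma> has_derivative (*) d) (at (z $ i))" by (simp add: has_field_derivative_def)
    have nth: "((\<lambda>w. w $ k) has_derivative (\<lambda>v. v $ k)) (at z)" for k :: 'n
      by (rule bounded_linear.has_derivative[OF bounded_linear_vec_nth has_derivative_ident])
    have deriv: "(\<psi> has_derivative (\<lambda>v. \<sigma> (z $ i) * v $ j + d * v $ i * z $ j)) (at z)"
      unfolding \<psi>_def[abs_def]
      by (rule has_derivative_mult[OF has_derivative_compose[OF nth d] nth])
    show "\<exists>D. ((\<lambda>z. diag_map S \<psi> z $ x) has_derivative D) (at z) \<and> (\<forall>c v. D (c *s v) = c * D v)"
    proof (cases "x \<in> S")
      case True
      with deriv show ?thesis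
        by (intro exI[of _ "\<lambda>v. \<sigma> (z $ i) * v $ j + d * v $ i * z $ j"])
          (simp add: diag_map_def algebra_simps)
    next
      case False
      then show ?thesis by (intro exI[of _ "\<lambda>v. 0"]) (simp add: diag_map_def)
    qed
  qed
qed

text \<open>The two coordinates are chosen independently: z_i makes |\<sigma>| exceed |w|, and the
  quotient w / \<sigma>(z_i) is then an admissible z_j.\<close>

lemma image_diag:
  assumes "\<And>w :: complex. norm w < 1 \<Longrightarrow> \<exists>x. norm x < 1 \<and> norm w < norm (\<sigma> x)"
  shows "diag_map S \<psi> ` polydisk = (\<lambda>w. \<chi> x. if x \<in> S then w else 0) ` ball 0 1"
proof (intro equalityI subsetI)
  fix y assume "y \<in> diag_map S \<psi> ` polydisk"
  then show "y \<in> (\<lambda>w. \<chi> x. if x \<in> S then w else 0) ` ball 0 1"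
    by (auto simp: diag_map_def norm_psi_less_1)
next
  fix y assume "y \<in> (\<lambda>w. \<chi> x. if x \<in> S then w else 0) ` ball (0::complex) 1"
  then obtain w where w: "norm w < 1" "y = (\<chi> x. if x \<in> S then w else 0)" by auto
  obtain x where x: "norm x < 1" "norm w < norm (\<sigma> x)" using assms[OF w(1)] by blast
  then have x0: "\<sigma> x \<noteq> 0" by auto
  define z where "z = (\<chi> t. if t = i then x else if t = j then w / \<sigma> x else 0)"
  have "z \<in> polydisk" using x x0 by (simp add: z_def polydisk_def norm_divide)
  moreover have "\<psi> z = w" using ij x0 by (simp add: \<psi>_def z_def)
  then have "diag_map S \<psi> z = y" unfolding diag_map_def w by (rule arg_cong)
  ultimately show "y \<in> diag_map S \<psi> ` polydisk" by blast
qed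

end

section \<open>From approximation numbers to the beta parameters\<close>

lemma approx_num_ge_imp_beta_minus_ge:
  fixes T :: "(complex ^ 'n::finite \<Rightarrow> complex) \<Rightarrow> complex ^ 'n \<Rightarrow> complex"
  assumes "\<And>n. 0 \<le> V n" "\<And>n. V n \<le> approx_num T (Suc n)"
    and lim: "(\<lambda>n. V n powr (1 / real (Suc n) powr (1 / real CARD('n)))) \<longlonglongrightarrow> L"
  shows "ereal L \<le> beta_minus T"
proof -
  \<comment> \<open>The bounds are numbered from 0 and the approximation numbers from 1; the index 0
    drops out in the limit.\<close>
  let ?Y = "\<lambda>n. V (n - 1) powr (1 / real n powr (1 / real CARD('n)))"
  have "?Y \<longlonglongrightarrow> L" by (rule LIMSEQ_imp_Suc) (use lim in simp)
  then have "liminf (\<lambda>n. ereal (?Y n)) = ereal L" by (intro lim_imp_Liminf) auto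
  moreover have "liminf (\<lambda>n. ereal (?Y n)) \<le> beta_minus T"
    unfolding beta_minus_def
  proof (rule Liminf_mono, rule eventually_sequentiallyI)
    fix n :: nat assume "n \<ge> 1"
    then obtain m where "n = Suc m" by (cases n) auto
    with assms(1,2)[of m] show "ereal (?Y n) \<le> ereal (approx_num T n powr (1 / real n powr (1 / real CARD('n))))"
      by (auto intro!: powr_mono2)
  qed
  ultimately show ?thesis by simp
qed

lemma approx_num_le_imp_beta_plus_le:
  fixes T :: "(complex ^ 'n::finite \<Rightarrow> complex) \<Rightarrow> complex ^ 'n \<Rightarrow> complex"
  assumes "\<And>n. 0 \<le> approx_num T (Suc n)" "\<And>n. approx_num T (Suc n) \<le> U n"
    and lim: "(\<lambda>n. U n powr (1 / real (Suc n) powr (1 / real CARD('n)))) \<longlonglongrightarrow> L"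
  shows "beta_plus T \<le> ereal L"
proof -
  let ?Y = "\<lambda>n. U (n - 1) powr (1 / real n powr (1 / real CARD('n)))"
  have "?Y \<longlonglongrightarrow> L" by (rule LIMSEQ_imp_Suc) (use lim in simp)
  then have "limsup (\<lambda>n. ereal (?Y n)) = ereal L" by (intro lim_imp_Limsup) auto
  moreover have "beta_plus T \<le> limsup (\<lambda>n. ereal (?Y n))"
    unfolding beta_plus_def
  proof (rule Limsup_mono, rule eventually_sequentiallyI)
    fix n :: nat assume "n \<ge> 1"
    then obtain m where "n = Suc m" by (cases n) auto
    with assms(1,2)[of m] show "ereal (approx_num T n powr (1 / real n powr (1 / real CARD('n)))) \<le> ereal (?Y n)"
      by (auto intro!: powr_mono2)
  qed
  ultimately show ?thesis by simp
qed

lemma beta_eqI: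
  assumes "ereal L \<le> beta_minus T" "beta_plus T \<le> ereal L"
  shows "beta_eq T (ereal L)"
proof -
  have "beta_minus T \<le> beta_plus T" unfolding beta_minus_def beta_plus_def by (rule Liminf_le_Limsup) simp
  with assms show ?thesis unfolding beta_eq_def by (meson order_antisym order_trans)
qed

text \<open>The critical rate: the root removes the constant \<open>C\<close>, and n^r / (n + 1)^r
  tends to 1, so exactly the rate \<open>c\<close> survives. The next two lemmas are the slower and
  the faster regime.\<close>

lemma tendsto_root_exp_eq:
  fixes C c r :: real
  assumes "C > 0" "c > 0" "r > 0"
  shows "(\<lambda>n. (C * exp (- (c * real n powr r))) powr (1 / real (Suc n) powr r)) \<longlonglongrightarrow> exp (- c)"
  using assms by real_asymp

lemma tendsto_root_exp_less:
  fixes C c q r :: real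
  assumes "C > 0" "c > 0" "r > 0" "q > 0" "q < r"
  shows "(\<lambda>n. (C * exp (- (c * real n powr q))) powr (1 / real (Suc n) powr r)) \<longlonglongrightarrow> 1"
  using assms by real_asymp

lemma tendsto_root_exp_greater:
  fixes C c q r :: real
  assumes "C > 0" "c > 0" "r > 0" "r < q"
  shows "(\<lambda>n. (C * exp (- (c * real n powr q))) powr (1 / real (Suc n) powr r)) \<longlonglongrightarrow> 0"
  using assms by real_asymp

lemma summable_exp_powr:
  fixes c q :: real
  assumes "c > 0" "q > 0"
  shows "summable (\<lambda>k. exp (- (c * real k powr q)))"
proof (rule summable_comparison_test_bigo)
  show "summable (\<lambda>k. norm (1 / real k ^ 2))"
    using inverse_power_summable[of 2, where 'a = real] by (simp add: field_simps)
  show "(\<lambda>k. exp (- (c * real k powr q))) \<in> O(\<lambda>k. 1 / real k ^ 2)"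
    using assms by real_asymp
qed

section \<open>Composition operators with cusp symbols\<close>

lemma cusp_surjectivity:
  fixes w :: complex
  assumes "p > 0" "norm w < 1"
  shows "\<exists>x. norm x < 1 \<and> norm w < norm (cusp p x)"
proof -
  have "((\<lambda>x. exp (- ((2 * p + 1 + x) powr (- p)))) \<longlongrightarrow> 1) at_top"
    using assms(1) by real_asymp
  then have "\<forall>\<^sub>F x in at_top. norm w < exp (- ((2 * p + 1 + x) powr (- p)))"
    using assms(2) by (rule order_tendstoD)
  then have "\<forall>\<^sub>F x in at_top. norm w < exp (- ((2 * p + 1 + x) powr (- p))) \<and> x \<ge> 0"
    by (intro eventually_conj eventually_ge_at_top)
  then obtain x where x: "norm w < exp (- ((2 * p + 1 + x) powr (- p)))" "x \<ge> 0"
    by (auto simp: eventually_at_top_linorder)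
  have "norm (of_real (1 - exp (- x)) :: complex) < 1"
    unfolding norm_of_real using x by simp
  moreover have "norm (cusp p (of_real (1 - exp (- x)))) = exp (- ((2 * p + 1 + x) powr (- p)))"
    unfolding cusp_real[OF assms(1) x(2)] norm_of_real by simp
  ultimately show ?thesis using x by metis
qed

text \<open>Half of the exponent absorbs the polynomial factor, through the bound \<open>B\<close>.
  The right side is written as a square because it serves as the majorant \<open>u\<close>; the
  square root halves the exponent once more, which gives \<open>a / 4\<close>.\<close>

lemma cusp_decay:
  assumes p: "p > 0"
  obtains C c where "C > 0" "c > 0"
    "\<And>k. real (k + 1) ^ N * (hardy_norm (\<lambda>z. cusp p z ^ k))\<^sup>2 \<le> (C * exp (- (c * real k powr (1 / (p + 1)))))\<^sup>2"
proof -
  define a where "a = (2 * p + 4) powr (- p)"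
  define q where "q = 1 / (p + 1)"
  have a: "a > 0" and q: "q > 0" using p by (auto simp: a_def q_def)
  have "(\<lambda>k. real (k + 1) powr N * exp (- (a / 2 * real k powr q))) \<longlonglongrightarrow> 0"
    using a q by real_asymp
  from convergent_imp_Bseq[OF convergentI[OF this]]
  obtain B where B: "B > 0" "\<And>k. norm (real (k + 1) powr N * exp (- (a / 2 * real k powr q))) \<le> B"
    by (elim BseqE) blast
  show ?thesis
  proof
    show "sqrt (3 * B) > 0" "a / 4 > 0" using B a by auto
    fix k
    have "real (k + 1) ^ N * (hardy_norm (\<lambda>z. cusp p z ^ k))\<^sup>2 \<le> real (k + 1) ^ N * (3 * exp (- (a * real k powr q)))"
      using hardy_norm_cusp_power_le[OF p, of k] unfolding a_def q_def by (intro mult_left_mono) auto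
    also have "exp (- (a * real k powr q)) = exp (- (a / 2 * real k powr q)) * exp (- (a / 2 * real k powr q))"
      by (simp add: exp_add[symmetric])
    also have "real (k + 1) ^ N * (3 * (exp (- (a / 2 * real k powr q)) * exp (- (a / 2 * real k powr q)))) =
        3 * (real (k + 1) powr N * exp (- (a / 2 * real k powr q))) * exp (- (a / 2 * real k powr q))"
      by (subst powr_realpow) (simp_all only: mult_ac of_nat_0_less_iff zero_less_Suc Suc_eq_plus1[symmetric])
    also have "\<dots> \<le> 3 * B * exp (- (a / 2 * real k powr q))"
      using B(2)[of k] by (intro mult_right_mono mult_left_mono) auto
    also have "\<dots> = (sqrt (3 * B) * exp (- (a / 4 * real k powr q)))\<^sup>2"
      using B(1) by (simp add: power_mult_distrib exp_double[symmetric])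
    finally show "real (k + 1) ^ N * (hardy_norm (\<lambda>z. cusp p z ^ k))\<^sup>2 \<le>
        (sqrt (3 * B) * exp (- (a / 4 * real k powr (1 / (p + 1)))))\<^sup>2"
      by (simp add: q_def)
  qed
qed

locale cusp_symbol =
  fixes i j :: "'n::finite" and p :: real and S :: "'n set"
  assumes ij: "i \<noteq> j" and p: "p > 0" and iS: "i \<in> S"
begin

sublocale product_symbol i j "cusp p"
  using ij holomorphic_cusp[OF p] norm_cusp_less_1[OF p] by unfold_locales (auto intro: less_imp_le)

abbreviation "\<Phi> \<equiv> diag_map S \<psi>"

lemma image: "\<Phi> ` polydisk = (\<lambda>w. \<chi> x. if x \<in> S then w else 0) ` ball 0 1"
  using cusp_surjectivity[OF p] by (rule image_diag)

lemma antimono_exp: "C \<ge> 0 \<Longrightarrow> a \<ge> 0 \<Longrightarrow> antimono (\<lambda>k. C * exp (- (a * real k powr (1 / (p + 1)))))"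
  using p by (intro antimonoI mult_left_mono) (auto intro!: mult_left_mono powr_mono2)

lemma decay:
  obtains C c where "C > 0" "c > 0"
    "\<And>k. real (card (deg_indices S k)) * (s k)\<^sup>2 \<le> (C * exp (- (c * real k powr (1 / (p + 1)))))\<^sup>2"
proof -
  obtain C c where Cc: "C > 0" "c > 0"
    "\<And>k. real (k + 1) ^ CARD('n) * (hardy_norm (\<lambda>z. cusp p z ^ k))\<^sup>2 \<le> (C * exp (- (c * real k powr (1 / (p + 1)))))\<^sup>2"
    using cusp_decay[OF p] by blast
  have "real (card (deg_indices S k)) * (s k)\<^sup>2 \<le> real (k + 1) ^ CARD('n) * (s k)\<^sup>2" for k
    using card_deg_indices_le[of S k] by (intro mult_right_mono) (metis of_nat_le_iff of_nat_power, simp)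
  then show ?thesis using that Cc unfolding s_def by (meson order_trans)
qed

lemma bounded: "comp_bounded \<Phi>"
proof -
  obtain C c where "C > 0" "c > 0"
    "\<And>k. real (card (deg_indices S k)) * (s k)\<^sup>2 \<le> (C * exp (- (c * real k powr (1 / (p + 1)))))\<^sup>2"
    using decay by blast
  then show ?thesis using antimono_exp[of C c]
    by (intro comp_bounded_diag[of "\<lambda>k. C * exp (- (c * real k powr (1 / (p + 1))))"]) auto
qed

lemma compact: "comp_compact \<Phi>"
proof (rule comp_compact_diag[OF bounded])
  obtain C c where C: "C > 0" "c > 0"
    "\<And>k. real (card (deg_indices S k)) * (s k)\<^sup>2 \<le> (C * exp (- (c * real k powr (1 / (p + 1)))))\<^sup>2"
    using decay by blast
  have "summable (\<lambda>k. C\<^sup>2 * exp (- (2 * c * real k powr (1 / (p + 1)))))"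
    using C p by (intro summable_mult summable_exp_powr) auto
  then show "summable (\<lambda>k. real (card (deg_indices S k)) * (s k)\<^sup>2)"
    by (rule summable_comparison_test') (use C(3) in \<open>simp add: power_mult_distrib exp_double[symmetric] mult.assoc\<close>)
qed

lemma approx_num_upper:
  obtains C c where "C > 0" "c > 0"
    "\<And>n. approx_num (comp_op \<Phi>) (Suc n) \<le> C * exp (- (c * real n powr (1 / (p + 1))))"
proof -
  obtain C c where C: "C > 0" "c > 0"
    "\<And>k. real (card (deg_indices S k)) * (s k)\<^sup>2 \<le> (C * exp (- (c * real k powr (1 / (p + 1)))))\<^sup>2"
    using decay by blast
  show ?thesis
    by (rule that[OF C(1,2)], rule approx_num_le) (use antimono_exp C in auto)
qed

text \<open>Half of the exponent 3 of the squared Hardy norm. The factor 1 keeps the form with a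
  leading constant that the monotonicity and limit lemmas expect.\<close>

lemma approx_num_lower: "1 * exp (- (3 / 2 * real n powr (1 / (p + 1)))) \<le> approx_num (comp_op \<Phi>) (Suc n)"
proof (rule approx_num_ge[OF iS bounded antimono_exp])
  fix k
  have "(1 * exp (- (3 / 2 * real k powr (1 / (p + 1)))))\<^sup>2 \<le> (s k)\<^sup>2"
    using hardy_norm_cusp_power_ge[OF p, of k] by (simp add: s_def exp_double[symmetric])
  then show "1 * exp (- (3 / 2 * real k powr (1 / (p + 1)))) \<le> s k"
    using s_nonneg by (rule power2_le_imp_le)
qed auto

lemma approx_num_nonneg: "0 \<le> approx_num (comp_op \<Phi>) (Suc n)"
  by (rule order_trans[OF _ approx_num_lower]) simp

lemma beta_eq_0:
  assumes "1 / real CARD('n) < 1 / (p + 1)"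
  shows "beta_eq (comp_op \<Phi>) 0"
proof -
  obtain C c where C: "C > 0" "c > 0"
    "\<And>n. approx_num (comp_op \<Phi>) (Suc n) \<le> C * exp (- (c * real n powr (1 / (p + 1))))"
    using approx_num_upper by blast
  have "beta_plus (comp_op \<Phi>) \<le> ereal 0"
    by (rule approx_num_le_imp_beta_plus_le[OF approx_num_nonneg C(3)], rule tendsto_root_exp_greater)
      (use C assms in auto)
  \<comment> \<open>The zero sequence is a sufficient lower bound here, all its roots being
    0.\<close>
  moreover have "ereal 0 \<le> beta_minus (comp_op \<Phi>)"
    by (rule approx_num_ge_imp_beta_minus_ge[of "\<lambda>_. 0"]) (auto simp: approx_num_nonneg)
  ultimately show ?thesis using beta_eqI[of 0] by (simp add: zero_ereal_def)
qed

lemma beta_eq_1: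
  assumes "1 / (p + 1) < 1 / real CARD('n)"
  shows "beta_eq (comp_op \<Phi>) 1"
proof -
  obtain C c where C: "C > 0" "c > 0"
    "\<And>n. approx_num (comp_op \<Phi>) (Suc n) \<le> C * exp (- (c * real n powr (1 / (p + 1))))"
    using approx_num_upper by blast
  have "beta_plus (comp_op \<Phi>) \<le> ereal 1"
    by (rule approx_num_le_imp_beta_plus_le[OF approx_num_nonneg C(3)], rule tendsto_root_exp_less)
      (use C assms p in auto)
  moreover have "ereal 1 \<le> beta_minus (comp_op \<Phi>)"
    by (rule approx_num_ge_imp_beta_minus_ge[OF _ approx_num_lower], simp, rule tendsto_root_exp_less)
      (use assms p in auto)
  ultimately show ?thesis using beta_eqI[of 1] by (simp add: one_ereal_def)
qed

lemma beta_between: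
  assumes "1 / (p + 1) = 1 / real CARD('n)"
  shows "beta_minus (comp_op \<Phi>) > 0" "beta_plus (comp_op \<Phi>) < 1"
proof -
  obtain C c where C: "C > 0" "c > 0"
    "\<And>n. approx_num (comp_op \<Phi>) (Suc n) \<le> C * exp (- (c * real n powr (1 / (p + 1))))"
    using approx_num_upper by blast
  have "beta_plus (comp_op \<Phi>) \<le> ereal (exp (- c))"
    by (rule approx_num_le_imp_beta_plus_le[OF approx_num_nonneg C(3)])
      (unfold assms, rule tendsto_root_exp_eq, use C in auto)
  also have "\<dots> < 1" using C by simp
  finally show "beta_plus (comp_op \<Phi>) < 1" .
  have "0 < ereal (exp (- (3 / 2)))" by simp
  also have "\<dots> \<le> beta_minus (comp_op \<Phi>)"
    by (rule approx_num_ge_imp_beta_minus_ge[OF _ approx_num_lower], simp)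
      (unfold assms, rule tendsto_root_exp_eq, auto)
  finally show "beta_minus (comp_op \<Phi>) > 0" .
qed

end

section \<open>The constant factor: failure of compactness and of boundedness\<close>

lemma has_coeffs_monom: "has_coeffs (\<lambda>z. monom z \<beta>) (\<lambda>\<alpha>. if \<alpha> = \<beta> then 1 else 0)"
  unfolding has_coeffs_def by (intro ballI has_sum_finite_neutralI[of "{\<beta>}"]) auto

locale coordinate_symbol =
  fixes i j :: "'n::finite"
  assumes ij: "i \<noteq> j"
begin

sublocale product_symbol i j "\<lambda>_. 1"
  using ij by unfold_locales auto

lemma psi_eq: "\<psi> z = z $ j"
  by (simp add: \<psi>_def)

lemma s_eq_1: "s k = 1"
proof -
  have "1 \<le> (s k)\<^sup>2"
    using norm_le_hardy_norm[of "\<lambda>z. 1 ^ k" 0] by (simp add: s_def)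
  then have "1 \<le> s k" by (intro power2_le_imp_le[OF _ s_nonneg]) simp
  with s_le_1[of k] show ?thesis by simp
qed

lemma image: "diag_map S \<psi> ` polydisk = (\<lambda>w. \<chi> x. if x \<in> S then w else 0) ` ball 0 1"
  by (rule image_diag) (auto intro: exI[of _ 0])

lemma bounded: "comp_bounded (diag_map {i} \<psi>)"
  by (rule comp_bounded_diag[of "\<lambda>_. 1"]) (use card_deg_indices_singleton in \<open>auto simp: s_eq_1 antimono_def\<close>)

text \<open>All singular values are 1, so every approximation number of positive index equals
  1.\<close>

lemma beta: "beta_eq (comp_op (diag_map {i} \<psi>)) 1"
proof -
  have le: "approx_num (comp_op (diag_map {i} \<psi>)) (Suc n) \<le> 1" for n
    by (rule approx_num_le[of "\<lambda>_. 1"]) (use card_deg_indices_singleton in \<open>auto simp: s_eq_1 antimono_def\<close>)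
  have ge: "1 \<le> approx_num (comp_op (diag_map {i} \<psi>)) (Suc n)" for n
    by (rule approx_num_ge[OF _ bounded, of "\<lambda>_. 1"]) (auto simp: s_eq_1 antimono_def)
  have "beta_plus (comp_op (diag_map {i} \<psi>)) \<le> ereal 1"
    by (rule approx_num_le_imp_beta_plus_le[OF _ le]) (use ge in \<open>auto intro: order_trans[OF zero_le_one]\<close>)
  moreover have "ereal 1 \<le> beta_minus (comp_op (diag_map {i} \<psi>))"
    by (rule approx_num_ge_imp_beta_minus_ge[OF _ ge]) auto
  ultimately show ?thesis using beta_eqI[of 1] by (simp add: one_ereal_def)
qed

text \<open>The powers of w_i are sent to the orthonormal powers of z_j. A limit \<open>g\<close>
  would have coefficients tending to 0 along these monomials, which keeps the images at distance
  nearly 1 from \<open>g\<close>.\<close>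

lemma not_compact: "\<not> comp_compact (diag_map {i} \<psi>)"
proof
  assume comp: "comp_compact (diag_map {i} \<psi>)"
  define fs where "fs t = (\<lambda>w :: complex ^ 'n. w $ i ^ t)" for t :: nat
  have fs_poly: "fs t = (\<lambda>w. \<Sum>k<Suc t. (if k = t then 1 else 0) * w $ i ^ k)" for t
    by (simp add: fs_def)
  have "fs t \<in> H2 \<and> h2norm (fs t) \<le> 1" for t
  proof
    show H: "fs t \<in> H2" unfolding fs_poly by (rule coordinate_polynomial_H2[OF ij])
    have "(h2norm (fs t))\<^sup>2 = 1"
      unfolding fs_poly coordinate_polynomial_H2(2)[OF ij] by simp
    then show "h2norm (fs t) \<le> 1" using h2norm_nonneg[OF H] by (simp add: power2_eq_1_iff)
  qed
  then obtain r g where r: "strict_mono r" and g: "g \<in> H2"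
    and lim: "(\<lambda>t. h2norm (\<lambda>z. comp_op (diag_map {i} \<psi>) (fs (r t)) z - g z)) \<longlonglongrightarrow> 0"
    using comp unfolding comp_compact_def by blast
  \<comment> \<open>The multi-index of the k-th power of z_j.\<close>
  let ?e = "\<lambda>k. two_index i j (k, 0)"
  have inj: "inj ?e" using inj_two_index[OF ij] by (auto simp: inj_def)
  have "(\<lambda>\<alpha>. (norm (h2coef g \<alpha>))\<^sup>2) summable_on range ?e"
    using has_sum_imp_summable[OF H2_has_sum[OF g]] by (rule summable_on_subset_banach) auto
  then have "summable (\<lambda>k. (norm (h2coef g (?e k)))\<^sup>2)"
    unfolding summable_on_reindex[OF inj] by (auto simp: o_def dest: summable_on_imp_summable)
  then have "(\<lambda>k. (norm (h2coef g (?e k)))\<^sup>2) \<longlonglongrightarrow> 0" by (rule summable_LIMSEQ_zero)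
  then have "(\<lambda>k. sqrt ((norm (h2coef g (?e k)))\<^sup>2)) \<longlonglongrightarrow> sqrt 0" by (rule tendsto_real_sqrt)
  then have "(\<lambda>k. norm (h2coef g (?e k))) \<longlonglongrightarrow> 0" by simp
  then have "((\<lambda>k. norm (h2coef g (?e k))) \<circ> r) \<longlonglongrightarrow> 0" by (rule LIMSEQ_subseq_LIMSEQ[OF _ r])
  from tendsto_add[OF lim this]
  have "(\<lambda>t. h2norm (\<lambda>z. comp_op (diag_map {i} \<psi>) (fs (r t)) z - g z) + norm (h2coef g (?e (r t)))) \<longlonglongrightarrow> 0"
    by (simp add: o_def)
  moreover have "1 \<le> h2norm (\<lambda>z. comp_op (diag_map {i} \<psi>) (fs t) z - g z) + norm (h2coef g (?e t))" for t
  proof -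
    let ?h = "\<lambda>z. comp_op (diag_map {i} \<psi>) (fs t) z - g z"
    let ?a = "\<lambda>\<alpha>. (if \<alpha> = ?e t then 1 else 0) + (- 1) * h2coef g \<alpha>"
    have h: "?h = (\<lambda>z. monom z (?e t) + (- 1) * g z)"
      by (simp add: comp_op_def diag_map_def fs_def psi_eq monom_two_index[OF ij])
    have coeffs: "has_coeffs ?h ?a"
      unfolding h by (intro has_coeffs_add has_coeffs_monom has_coeffs_mult H2_has_coeffs g)
    have "?h \<in> H2"
    proof -
      \<comment> \<open>Away from a single index the coefficients are those of \<open>g\<close> up
        to sign.\<close>
      have "(\<lambda>\<alpha>. (norm (?a \<alpha>))\<^sup>2) summable_on - {?e t}"
        using summable_on_subset_banach[OF has_sum_imp_summable[OF H2_has_sum[OF g]], of "- {?e t}"]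
        by (rule summable_on_cong[THEN iffD1, rotated]) auto
      then have "(\<lambda>\<alpha>. (norm (?a \<alpha>))\<^sup>2) summable_on insert (?e t) (- {?e t})"
        by (simp add: summable_on_insert_iff)
      also have "insert (?e t) (- {?e t}) = UNIV" by auto
      finally show ?thesis using coeffs unfolding H2_def by blast
    qed
    from finite_sum_le_has_sum[OF H2_has_sum[OF this], of "{?e t}"]
    have "(norm (?a (?e t)))\<^sup>2 \<le> (h2norm ?h)\<^sup>2"
      unfolding h2coef_eqI[OF coeffs] by simp
    then have "norm (?a (?e t)) \<le> h2norm ?h"
      by (rule power2_le_imp_le) (rule h2norm_nonneg[OF \<open>?h \<in> H2\<close>])
    moreover have "1 \<le> norm (?a (?e t)) + norm (h2coef g (?e t))"
      using norm_triangle_ineq[of "?a (?e t)" "h2coef g (?e t)"] by simp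
    ultimately show ?thesis by linarith
  qed
  ultimately have "(1::real) \<le> 0" by (intro LIMSEQ_le_const) auto
  then show False by simp
qed

text \<open>The k + 1 monomials of degree k in w_i and w_j are orthonormal but all collapse to the
  k-th power of z_j. Their sum has norm sqrt (k + 1) and its image has norm k + 1, so the operator
  norm is at least sqrt (k + 1).\<close>

lemma not_bounded: "\<not> comp_bounded (diag_map UNIV \<psi>)"
proof
  assume "comp_bounded (diag_map UNIV \<psi>)"
  then obtain C where C: "\<And>f. f \<in> H2 \<Longrightarrow> h2norm (comp_op (diag_map UNIV \<psi>) f) \<le> C * h2norm f"
    unfolding comp_bounded_def by blast
  have bound: "sqrt (real (k + 1)) \<le> C" for k
  proof -
    let ?I = "(\<lambda>m. (k - m, m)) ` {..k}"
    let ?A = "\<lambda>v. if v \<in> ?I then 1 else (0 :: complex)"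
    define f where "f w = (\<Sum>m\<le>k. w $ i ^ m * w $ j ^ (k - m))" for w :: "complex ^ 'n"
    have inj: "inj_on (\<lambda>m. (k - m, m)) {..k}" by (auto simp: inj_on_def)
    have 1: "((\<lambda>(q, m). ?A (q, m) * (z $ i ^ m * z $ j ^ q)) has_sum f z) UNIV" for z :: "complex ^ 'n"
      by (rule has_sum_finite_neutralI[of ?I]) (auto simp: sum.reindex[OF inj] f_def)
    have 2: "((\<lambda>v. (norm (?A v))\<^sup>2) has_sum real (k + 1)) UNIV"
      by (rule has_sum_finite_neutralI[of ?I]) (auto simp: card_image[OF inj])
    note cf = has_coeffs_two_index[OF ij 1]
    have f: "f \<in> H2" "h2norm f = sqrt (real (k + 1))"
      using h2norm_eqI[OF cf(1) cf(3)[OF 2]] by auto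
    have comp: "comp_op (diag_map UNIV \<psi>) f = (\<lambda>z. of_nat (k + 1) * monom z (two_index i j (k, 0)))"
      by (auto simp: comp_op_def diag_map_def f_def psi_eq monom_two_index[OF ij] power_add[symmetric])
    have "h2norm (comp_op (diag_map UNIV \<psi>) f) = sqrt ((real (k + 1))\<^sup>2)"
      unfolding comp
    proof (rule h2norm_eqI(2)[OF has_coeffs_mult[OF has_coeffs_monom]])
      show "((\<lambda>\<alpha>. (norm (of_nat (k + 1) * (if \<alpha> = two_index i j (k, 0) then 1 else 0) :: complex))\<^sup>2)
          has_sum (real (k + 1))\<^sup>2) UNIV"
        by (rule has_sum_finite_neutralI[of "{two_index i j (k, 0)}"])
          (auto simp: norm_mult simp del: of_nat_Suc of_nat_add)
    qed
    with C[OF f(1)] f(2) have "sqrt (real (k + 1)) * sqrt (real (k + 1)) \<le> C * sqrt (real (k + 1))" by simp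
    then show ?thesis by (rule mult_right_le_imp_le) simp
  qed
  obtain k :: nat where "C\<^sup>2 < real k" using reals_Archimedean2 by blast
  then have "C < sqrt (real (k + 1))" by (intro real_less_rsqrt) simp
  with bound[of k] show False by simp
qed

end

section \<open>Assembling the four pairs\<close>

theorem theorem4p1:
  assumes "CARD('n) \<ge> 2"
  shows
   "(\<exists>\<Phi>1 \<Phi>2 :: complex ^ 'n \<Rightarrow> complex ^ 'n.
       analytic_self_map \<Phi>1 \<and> analytic_self_map \<Phi>2 \<and> \<Phi>1 ` polydisk = \<Phi>2 ` polydisk \<and>
       \<not> comp_bounded \<Phi>1 \<and>
       comp_compact \<Phi>2 \<and> beta_eq (comp_op \<Phi>2) 0)
  \<and> (\<exists>\<Phi>1 \<Phi>2 :: complex ^ 'n \<Rightarrow> complex ^ 'n.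
       analytic_self_map \<Phi>1 \<and> analytic_self_map \<Phi>2 \<and> \<Phi>1 ` polydisk = \<Phi>2 ` polydisk \<and>
       comp_bounded \<Phi>1 \<and> \<not> comp_compact \<Phi>1 \<and> beta_eq (comp_op \<Phi>1) 1 \<and>
       comp_compact \<Phi>2 \<and> beta_eq (comp_op \<Phi>2) 0)
  \<and> (\<exists>\<Phi>1 \<Phi>2 :: complex ^ 'n \<Rightarrow> complex ^ 'n.
       analytic_self_map \<Phi>1 \<and> analytic_self_map \<Phi>2 \<and> \<Phi>1 ` polydisk = \<Phi>2 ` polydisk \<and>
       comp_compact \<Phi>1 \<and> beta_minus (comp_op \<Phi>1) > 0 \<and> beta_plus (comp_op \<Phi>1) < 1 \<and>
       comp_compact \<Phi>2 \<and> beta_eq (comp_op \<Phi>2) 0)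
  \<and> (\<exists>\<Phi>1 \<Phi>2 :: complex ^ 'n \<Rightarrow> complex ^ 'n.
       analytic_self_map \<Phi>1 \<and> analytic_self_map \<Phi>2 \<and> \<Phi>1 ` polydisk = \<Phi>2 ` polydisk \<and>
       comp_compact \<Phi>1 \<and> beta_eq (comp_op \<Phi>1) 1 \<and>
       comp_compact \<Phi>2 \<and> beta_eq (comp_op \<Phi>2) 0)"
proof -
  obtain i j :: 'n where ij: "i \<noteq> j"
    using assms by (metis (full_types) UNIV_I card_le_Suc0_iff_eq finite not_less_eq_eq numeral_2_eq_2)
  interpret Z: coordinate_symbol i j using ij by unfold_locales
  \<comment> \<open>The value 1/2 gives the exponent 2/3, which exceeds 1/N for every N \<ge> 2. Two
    diagonals are needed, since the image must agree with that of the partner: all coordinates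
    against the unbounded operator, one coordinate in the other three cases.\<close>
  interpret A: cusp_symbol i j "1 / 2" UNIV using ij by unfold_locales auto
  interpret B: cusp_symbol i j "1 / 2" "{i}" using ij by unfold_locales auto
  interpret E: cusp_symbol i j "real CARD('n) - 1" "{i}" using ij assms by unfold_locales auto
  interpret F: cusp_symbol i j "real CARD('n)" "{i}" using ij assms by unfold_locales auto
  have lt: "1 / real CARD('n) < 1 / (1 / 2 + 1)" using assms by (simp add: field_simps)
  \<comment> \<open>\<open>A\<close> and \<open>B\<close> share the function \<psi>, into which
    \<open>S\<close> does not enter, so the fact from \<open>A\<close> applied to the set
    \<open>{i}\<close> is the one about \<open>B\<close>.\<close>
  note B = A.analytic_self_map_diag[of "{i}"] B.compact B.beta_eq_0[OF lt]
  have image_A: "diag_map UNIV Z.\<psi> ` polydisk = A.\<Phi> ` polydisk"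
    by (rule trans[OF Z.image A.image[symmetric]])
  have image_Z: "diag_map {i} Z.\<psi> ` polydisk = B.\<Phi> ` polydisk"
    by (rule trans[OF Z.image B.image[symmetric]])
  have image_E: "E.\<Phi> ` polydisk = B.\<Phi> ` polydisk" by (rule trans[OF E.image B.image[symmetric]])
  have image_F: "F.\<Phi> ` polydisk = B.\<Phi> ` polydisk" by (rule trans[OF F.image B.image[symmetric]])
  have E_exp: "1 / (real CARD('n) - 1 + 1) = 1 / real CARD('n)" by simp
  have F_exp: "1 / (real CARD('n) + 1) < 1 / real CARD('n)" by (simp add: field_simps)
  show ?thesis
    by (rule conjI[OF exI[of _ "diag_map UNIV Z.\<psi>", OF exI[of _ A.\<Phi>]]
            conjI[OF exI[of _ "diag_map {i} Z.\<psi>", OF exI[of _ B.\<Phi>]]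
              conjI[OF exI[of _ E.\<Phi>, OF exI[of _ B.\<Phi>]] exI[of _ F.\<Phi>, OF exI[of _ B.\<Phi>]]]]];
        intro conjI; fact Z.analytic_self_map_diag A.analytic_self_map_diag E.analytic_self_map_diag
          F.analytic_self_map_diag image_A image_Z image_E image_F Z.not_bounded Z.bounded Z.not_compact Z.beta
          A.compact A.beta_eq_0[OF lt] B E.compact E.beta_between[OF E_exp] F.compact F.beta_eq_1[OF F_exp])
qed

end
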